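(* Let $\ell$ be a prime and $t$ an integer. Then for every integer $k\ge3$, $$\frac{S(t;\ell^k)}{\ell^{5k-5}}=\begin{cases} \ell^2(\ell^2+1)(\ell-1)&\text{if }\ell\mid t\text{ and }\ell>2,\\ \frac{\ell^2(\ell^4-2\ell^2-3\ell-1)}{\ell+1}-\frac{\ell^4}{\ell^{2k}(\ell+1)}&\text{if }\ell\nmid 2t,\\ 4&\text{if }\ell=2\text{ and }2\nmid t,\\ \frac{35}{2}&\text{if }\ell=2\text{ and }4\mid t,\\ \frac{103}{6}-\frac{32}{3\cdot 2^{2k}}&\text{if }\ell=2,\ 2\mid t,\text{ and }4\nmid t. \end{cases}$$
   Context: For a prime $\ell$, an integer $k\ge1$ and $t,u\in\mathbb{Z}/\ell^k\mathbb{Z}$, let $m(t,u;\ell^k)$ be the number of $2\times2$ matrices $A$ with entries in $\mathbb{Z}/\ell^k\mathbb{Z}$ with $\operatorname{tr}(A)=t$ and $\det(A)=u$. For an integer $t$ set $S(t;\ell^k):=\sum_{u\in(\mathbb{Z}/\ell^k\mathbb{Z})^*}m(t,u;\ell^k)^2$. *)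

theory Defs
  imports "HOL-Analysis.Analysis" "HOL-Number_Theory.Residues"
begin

text \<open>
  Elements of $\mathbb{Z}/N\mathbb{Z}$ are represented by integers in the carrier
  $\{0,\dots,N-1\}$ of the residue ring, and a matrix over $\mathbb{Z}/N\mathbb{Z}$ by the
  integer matrix of its representatives.  Reduction modulo $N$ is a ring homomorphism, so the
  trace and determinant over $\mathbb{Z}/N\mathbb{Z}$ are the residue classes of those of the
  integer matrix.  The arguments t and u matter only modulo N.
\<close>

definition mat_count :: "int \<Rightarrow> int \<Rightarrow> int \<Rightarrow> nat" where
  "mat_count t u N =
     card {A :: int^2^2. (\<forall>i j. A $ i $ j \<in> carrier (residue_ring N)) \<and>
                         [trace A = t] (mod N) \<and> [det A = u] (mod N)}"

definition S :: "int \<Rightarrow> int \<Rightarrow> nat" where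
  "S t N = (\<Sum>u\<in>Units (residue_ring N). (mat_count t u N)\<^sup>2)"

end

theory Submission
  imports Defs
begin

text \<open>
  If $t = 2h$ modulo $N = l^k$, then subtracting the scalar matrix h turns a matrix of trace t and
  determinant u into one of trace 0 and determinant $u - h^2$, so $m(t, u; N)$ is the number
  $G_k(D)$ of solutions of $x^2 + bc = D$ modulo N with $D = h^2 - u$.  When D is a unit, $G_k(D)$
  is determined by the number of square roots of units.  When l divides D exactly once, only
  solutions with b or c a unit occur.  When $D = l^2 D'$, the remaining solutions are divisible
  by l, which gives $G_k(l^2 D') = l^{2k-2}(l^2-1) + l^3 G_{k-2}(D')$.  As
  $\sum_D G_k(D) = l^{3k}$, squaring and summing yields a two-step recursion for
  $\sum_D G_k(D)^2$.  The condition that $u = h^2 - D$ be a unit selects the units D if l divides h,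
  and for odd l not dividing h it excludes a single residue class modulo l, in which $G_k$
  is constant.  For $l = 2$ and odd t, all $m(t, u; N)$ with u odd are equal.
\<close>

section \<open>Sums over residues\<close>

text \<open>Since \<open>a\<close> is a unit modulo \<open>N\<close>, the affine map is injective on
  the finite set of residues, hence permutes it. With a = 1 or a = -1 it provides the shifts and
  reflections used below.\<close>

lemma sum_residues_affine:
  fixes f :: "int \<Rightarrow> 'a::comm_monoid_add" and N :: int
  assumes f: "\<And>x y. [x = y] (mod N) \<Longrightarrow> f x = f y" and "N > 0" "coprime a N"
  shows "(\<Sum>x\<in>{0..<N}. f (a * x + h)) = (\<Sum>x\<in>{0..<N}. f x)"
proof -
  define g where "g x = (a * x + h) mod N" for x
  have "inj_on g {0..<N}"
  proof (rule inj_onI)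
    fix x y assume xy: "x \<in> {0..<N}" "y \<in> {0..<N}" and "g x = g y"
    then have "[a * x + h = a * y + h] (mod N)" by (simp add: g_def cong_def)
    then have "[a * x = a * y] (mod N)" using cong_add_rcancel by blast
    then have "[x = y] (mod N)"
      using \<open>coprime a N\<close> cong_mult_lcancel by blast
    then show "x = y" using xy by (simp add: cong_def)
  qed
  moreover have "g ` {0..<N} \<subseteq> {0..<N}" using \<open>N > 0\<close> by (auto simp: g_def)
  ultimately have "bij_betw g {0..<N} {0..<N}"
    by (simp add: bij_betw_def endo_inj_surj)
  then have "(\<Sum>x\<in>{0..<N}. f (g x)) = (\<Sum>x\<in>{0..<N}. f x)"
    by (rule sum.reindex_bij_betw)
  moreover have "f (g x) = f (a * x + h)" for x
    by (rule f) (simp add: g_def cong_def)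
  ultimately show ?thesis by simp
qed

lemma sum_residues_mult:
  fixes f :: "int \<Rightarrow> int"
  assumes f: "\<And>x y. [x = y] (mod N) \<Longrightarrow> f x = f y" and "N > 0" "M \<ge> 0"
  shows "(\<Sum>x\<in>{0..<M * N}. f x) = M * (\<Sum>x\<in>{0..<N}. f x)"
proof -
  \<comment> \<open>The interval consists of m blocks of length \<open>N\<close>, each a translate
    of the first by a multiple of \<open>N\<close>. The multiplier is taken as a natural number to
    allow induction.\<close>
  have "(\<Sum>x\<in>{0..<int m * N}. f x) = int m * (\<Sum>x\<in>{0..<N}. f x)" for m
  proof (induction m)
    case (Suc m)
    have "{0..<int (Suc m) * N} = {0..<int m * N} \<union> {int m * N..<int m * N + N}"
      using \<open>N > 0\<close> ivl_disj_un_two(3)[of 0 "int m * N" "int m * N + N"]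
      by (simp add: algebra_simps)
    then have "(\<Sum>x\<in>{0..<int (Suc m) * N}. f x)
        = (\<Sum>x\<in>{0..<int m * N}. f x) + (\<Sum>x\<in>{int m * N..<int m * N + N}. f x)"
      by (simp only:) (rule sum.union_disjoint, auto)
    also have "(\<Sum>x\<in>{int m * N..<int m * N + N}. f x) = (\<Sum>x\<in>{0..<N}. f x)"
    proof (rule sum.reindex_bij_witness[of _ "\<lambda>x. x + int m * N" "\<lambda>x. x - int m * N"])
      fix x show "f (x - int m * N) = f x" by (rule f) (simp add: cong_iff_dvd_diff)
    qed auto
    finally show ?case using Suc by (simp add: algebra_simps)
  qed simp
  from this[of "nat M"] show ?thesis using \<open>M \<ge> 0\<close> by simp
qed

lemma sum_residues_multiples:
  fixes f :: "int \<Rightarrow> 'a::semiring_1"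
  assumes "l > 0"
  shows "(\<Sum>x\<in>{0..<l * N}. of_bool (l dvd x) * f x) = (\<Sum>y\<in>{0..<N}. f (l * y))"
proof -
  have "(\<Sum>x\<in>{0..<l * N}. of_bool (l dvd x) * f x)
      = (\<Sum>x\<in>{x\<in>{0..<l * N}. l dvd x}. f x)"
    by (simp only: sum.inter_filter[OF finite_atLeastLessThan_int])
      (rule sum.cong, auto)
  also have "\<dots> = (\<Sum>y\<in>{0..<N}. f (l * y))"
    using assms
    by (intro sum.reindex_bij_witness[of _ "\<lambda>y. l * y" "\<lambda>x. x div l"])
      (auto simp: zero_le_mult_iff elim!: dvdE)
  finally show ?thesis .
qed

text \<open>Case distinctions are encoded as 0/1 weights on a fixed index set, so that sums over
  different variables can still be swapped freely.\<close>

lemma sum_split_bool: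
  fixes f :: "'b \<Rightarrow> 'a::ring_1"
  shows "(\<Sum>x\<in>A. f x) = (\<Sum>x\<in>A. of_bool (\<not> P x) * f x) + (\<Sum>x\<in>A. of_bool (P x) * f x)"
  by (simp add: sum.distrib[symmetric]) (rule sum.cong, auto)

text \<open>The affine substitution turns the condition into N | x, which only the residue 0
  satisfies.\<close>

lemma sum_residues_linear:
  fixes a h N :: int
  assumes "N > 0" "coprime a N"
  shows "(\<Sum>x\<in>{0..<N}. of_bool (N dvd a * x + h) :: int) = 1"
proof -
  have "(\<Sum>x\<in>{0..<N}. of_bool (N dvd a * x + h) :: int) = (\<Sum>x\<in>{0..<N}. of_bool (N dvd x))"
    using assms
    by (intro sum_residues_affine[where f = "\<lambda>x. of_bool (N dvd x)"])
      (simp_all only: cong_dvd_iff)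
  also have "\<dots> = (\<Sum>x\<in>{0..<N}. if x = 0 then 1 else 0)"
    by (rule sum.cong) (auto dest: zdvd_imp_le)
  also have "\<dots> = 1" using \<open>N > 0\<close> by simp
  finally show ?thesis .
qed

lemma sum_residues_coprime:
  assumes "l > 0" "N \<ge> 0"
  shows "(\<Sum>x\<in>{0..<l * N}. of_bool (\<not> l dvd x) :: int) = l * N - N"
proof -
  have "(\<Sum>x\<in>{0..<l * N}. 1 :: int)
      = (\<Sum>x\<in>{0..<l * N}. of_bool (\<not> l dvd x)) + (\<Sum>x\<in>{0..<l * N}. of_bool (l dvd x))"
    using sum_split_bool[of "\<lambda>_. 1::int" "{0..<l * N}" "\<lambda>x. l dvd x"] by simp
  moreover have "(\<Sum>x\<in>{0..<l * N}. of_bool (l dvd x) :: int) = N"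
    using sum_residues_multiples[where l = l and N = N and f = "\<lambda>_. 1::int"] assms by simp
  moreover have "0 \<le> l * N" using assms by simp
  ultimately show ?thesis by simp
qed

section \<open>Solutions of $x^2 + bc = D$\<close>

text \<open>
  tz_count N D is the number of matrices modulo N with trace 0 and determinant $-D$,
  written with rows $(x, b)$ and $(c, -x)$.
\<close>

definition tz_count :: "int \<Rightarrow> int \<Rightarrow> int" where
  "tz_count N D =
     (\<Sum>x\<in>{0..<N}. \<Sum>b\<in>{0..<N}. \<Sum>c\<in>{0..<N}. of_bool (N dvd x\<^sup>2 + b * c - D))"

definition sqrt_count :: "int \<Rightarrow> int \<Rightarrow> int" where
  "sqrt_count N D = (\<Sum>x\<in>{0..<N}. of_bool (N dvd x\<^sup>2 - D))"

lemma tz_count_cong: "[D = E] (mod N) \<Longrightarrow> tz_count N D = tz_count N E"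
  unfolding tz_count_def
  by (intro sum.cong refl arg_cong[where f = of_bool] cong_dvd_iff cong_diff cong_refl)

lemma sqrt_count_cong: "[D = E] (mod N) \<Longrightarrow> sqrt_count N D = sqrt_count N E"
  unfolding sqrt_count_def
  by (intro sum.cong refl arg_cong[where f = of_bool] cong_dvd_iff cong_diff cong_refl)

text \<open>Every triple (x, b, c) is a solution for exactly one residue D, so all triples are
  counted once. This evaluates the cross term when \<open>tz_count\<close> is squared in the
  recursion.\<close>

lemma sum_tz_count:
  assumes "N > 0"
  shows "(\<Sum>D\<in>{0..<N}. tz_count N D) = N ^ 3"
proof -
  have "(\<Sum>D\<in>{0..<N}. tz_count N D) = (\<Sum>x\<in>{0..<N}. \<Sum>D\<in>{0..<N}. \<Sum>b\<in>{0..<N}. \<Sum>c\<in>{0..<N}. of_bool (N dvd x\<^sup>2 + b * c - D))"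
    unfolding tz_count_def by (rule sum.swap)
  also have "\<dots> = (\<Sum>x\<in>{0..<N}. \<Sum>b\<in>{0..<N}. \<Sum>D\<in>{0..<N}. \<Sum>c\<in>{0..<N}. of_bool (N dvd x\<^sup>2 + b * c - D))"
    by (intro sum.cong refl sum.swap)
  also have "\<dots> = (\<Sum>x\<in>{0..<N}. \<Sum>b\<in>{0..<N}. \<Sum>c\<in>{0..<N}. \<Sum>D\<in>{0..<N}. of_bool (N dvd x\<^sup>2 + b * c - D))"
    by (intro sum.cong refl sum.swap)
  also have "\<dots> = (\<Sum>x\<in>{0..<N}. \<Sum>b\<in>{0..<N}. \<Sum>c\<in>{0..<N}. 1)"
  proof (intro sum.cong refl)
    fix x b c
    show "(\<Sum>D\<in>{0..<N}. of_bool (N dvd x\<^sup>2 + b * c - D)) = (1::int)"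
      using sum_residues_linear[OF assms, of "-1" "x\<^sup>2 + b * c"] by simp
  qed
  also have "\<dots> = N ^ 3" using assms by (simp add: power3_eq_cube)
  finally show ?thesis .
qed

text \<open>
  If b or c is a unit, then the other two variables are free and the equation
  $x^2 + bc = D$ is linear in the remaining one; the last sum collects the solutions in which
  both b and c are divisible by l.
\<close>

lemma tz_count_split:
  fixes l :: int
  assumes "prime l"
  shows "tz_count (l ^ Suc n) D = l ^ Suc n * (l ^ Suc n - l ^ n)
      + (l ^ Suc n - l ^ n) * (l ^ n * sqrt_count l D)
      + (\<Sum>x\<in>{0..<l ^ Suc n}. \<Sum>b\<in>{0..<l ^ n}. \<Sum>c\<in>{0..<l ^ n}.
           of_bool (l ^ Suc n dvd x\<^sup>2 + l\<^sup>2 * (b * c) - D))"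
proof -
  define N where "N = l ^ Suc n"
  define phi where "phi = l ^ Suc n - l ^ n"
  define F :: "int \<Rightarrow> int \<Rightarrow> int \<Rightarrow> int" where "F x b c = of_bool (N dvd x\<^sup>2 + b * c - D)" for x b c
  have l0: "l > 0" using assms by (simp add: prime_gt_0_int)
  have N0: "N > 0" and N: "N = l * l ^ n" using l0 by (simp_all add: N_def)
  have lN: "l dvd N" by (simp add: N)
  have cop: "coprime a N" if "\<not> l dvd a" for a
    using that prime_imp_coprime[OF assms] by (simp add: N_def coprime_commute)
  have phi: "(\<Sum>b\<in>{0..<N}. of_bool (\<not> l dvd b)) = phi"
    unfolding N phi_def using sum_residues_coprime[OF l0, of "l ^ n"] l0 by simp
  have "(\<Sum>b\<in>{0..<N}. \<Sum>c\<in>{0..<N}. F x b c)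
      = phi + phi * of_bool (l dvd x\<^sup>2 - D)
       + (\<Sum>b\<in>{0..<l ^ n}. \<Sum>c\<in>{0..<l ^ n}. of_bool (N dvd x\<^sup>2 + l\<^sup>2 * (b * c) - D))" for x
  proof -
    have 1: "(\<Sum>c\<in>{0..<N}. F x b c) = 1" if "\<not> l dvd b" for b
      using sum_residues_linear[OF N0 cop[OF that], of "x\<^sup>2 - D"]
      by (simp add: F_def algebra_simps)
    have 2: "(\<Sum>b\<in>{0..<N}. of_bool (l dvd b) * F x b c) = of_bool (l dvd x\<^sup>2 - D)"
      if "\<not> l dvd c" for c
    proof -
      \<comment> \<open>Modulo l a solution satisfies x^2 - D + bc = 0. Since c is a unit there, l
        divides b exactly if it divides x^2 - D. The restriction thus moves from b to x, and b is
        determined by a linear equation.\<close>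
      have "of_bool (l dvd b) * F x b c = of_bool (l dvd x\<^sup>2 - D) * F x b c" for b
      proof (cases "N dvd x\<^sup>2 + b * c - D")
        case True
        then have "l dvd x\<^sup>2 + b * c - D" using lN dvd_trans by blast
        then have "l dvd (x\<^sup>2 - D) + b * c" by (simp add: algebra_simps)
        then have "l dvd x\<^sup>2 - D \<longleftrightarrow> l dvd b * c"
          by (metis dvd_add_right_iff add.commute)
        also have "\<dots> \<longleftrightarrow> l dvd b" using that assms by (simp add: prime_dvd_mult_iff)
        finally show ?thesis by simp
      qed (simp add: F_def)
      then have "(\<Sum>b\<in>{0..<N}. of_bool (l dvd b) * F x b c)
          = of_bool (l dvd x\<^sup>2 - D) * (\<Sum>b\<in>{0..<N}. F x b c)"
        by (simp only: sum_distrib_left)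
      also have "(\<Sum>b\<in>{0..<N}. F x b c) = 1"
        using sum_residues_linear[OF N0 cop[OF that], of "x\<^sup>2 - D"]
        by (simp add: F_def algebra_simps)
      finally show ?thesis by simp
    qed
    have "(\<Sum>b\<in>{0..<N}. \<Sum>c\<in>{0..<N}. F x b c)
        = (\<Sum>b\<in>{0..<N}. of_bool (\<not> l dvd b) * (\<Sum>c\<in>{0..<N}. F x b c))
        + (\<Sum>b\<in>{0..<N}. of_bool (l dvd b) * (\<Sum>c\<in>{0..<N}. F x b c))"
      by (rule sum_split_bool)
    also have "(\<Sum>b\<in>{0..<N}. of_bool (\<not> l dvd b) * (\<Sum>c\<in>{0..<N}. F x b c)) = phi"
      unfolding phi[symmetric] 
    proof (intro sum.cong refl)
      fix y show "of_bool (\<not> l dvd y) * (\<Sum>c\<in>{0..<N}. F x y c) = of_bool (\<not> l dvd y)"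
        by (cases "l dvd y") (simp_all add: 1)
    qed
    also have "(\<Sum>b\<in>{0..<N}. of_bool (l dvd b) * (\<Sum>c\<in>{0..<N}. F x b c))
        = (\<Sum>c\<in>{0..<N}. \<Sum>b\<in>{0..<N}. of_bool (l dvd b) * F x b c)"
      unfolding sum_distrib_left by (rule sum.swap)
    \<comment> \<open>With l | b already imposed and the sums swapped, the same division is made for
      c. What remains has both divisible by l and is reindexed by their quotients, which run modulo
      l^n.\<close>
    also have "\<dots> = (\<Sum>c\<in>{0..<N}. of_bool (\<not> l dvd c) * (\<Sum>b\<in>{0..<N}. of_bool (l dvd b) * F x b c))
        + (\<Sum>c\<in>{0..<N}. of_bool (l dvd c) * (\<Sum>b\<in>{0..<N}. of_bool (l dvd b) * F x b c))"
      by (rule sum_split_bool)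
    also have "(\<Sum>c\<in>{0..<N}. of_bool (\<not> l dvd c) * (\<Sum>b\<in>{0..<N}. of_bool (l dvd b) * F x b c))
        = phi * of_bool (l dvd x\<^sup>2 - D)"
      unfolding phi[symmetric] sum_distrib_right 
    proof (intro sum.cong refl)
      fix y show "of_bool (\<not> l dvd y) * (\<Sum>b\<in>{0..<N}. of_bool (l dvd b) * F x b y) = of_bool (\<not> l dvd y) * of_bool (l dvd x\<^sup>2 - D)"
        by (cases "l dvd y") (simp_all only: 2 of_bool_eq simp_thms mult_zero_left mult_1_left)
    qed
    also have "(\<Sum>c\<in>{0..<N}. of_bool (l dvd c) * (\<Sum>b\<in>{0..<N}. of_bool (l dvd b) * F x b c))
        = (\<Sum>c\<in>{0..<l ^ n}. \<Sum>b\<in>{0..<l ^ n}. F x (l * b) (l * c))"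
      unfolding N by (simp only: sum_residues_multiples[OF l0])
    also have "\<dots> = (\<Sum>b\<in>{0..<l ^ n}. \<Sum>c\<in>{0..<l ^ n}. F x (l * b) (l * c))"
      by (rule sum.swap)
    finally show ?thesis
      by (simp add: F_def power2_eq_square mult.assoc mult.left_commute)
  qed
  then have "tz_count N D = N * phi + phi * (\<Sum>x\<in>{0..<N}. of_bool (l dvd x\<^sup>2 - D))
     + (\<Sum>x\<in>{0..<N}. \<Sum>b\<in>{0..<l ^ n}. \<Sum>c\<in>{0..<l ^ n}. of_bool (N dvd x\<^sup>2 + l\<^sup>2 * (b * c) - D))"
    using N0 unfolding tz_count_def F_def by (simp add: sum.distrib sum_distrib_left)
  \<comment> \<open>The condition depends on x only modulo l, and each class modulo l has l^n lifts
    modulo \<open>N\<close>.\<close>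
  moreover have "(\<Sum>x\<in>{0..<N}. of_bool (l dvd x\<^sup>2 - D)) = l ^ n * sqrt_count l D"
    unfolding sqrt_count_def N mult.commute[of l]
    using l0 by (intro sum_residues_mult arg_cong[where f = of_bool] cong_dvd_iff
        cong_diff cong_pow cong_refl) simp_all
  ultimately show ?thesis by (simp add: N_def phi_def)
qed

section \<open>Values at multiples of l and the two-step recursion\<close>

lemma sqrt_count_multiple:
  fixes l :: int
  assumes "prime l" "l dvd D"
  shows "sqrt_count l D = 1"
proof -
  have "l dvd x\<^sup>2 - D \<longleftrightarrow> l dvd 1 * x + 0" for x
    using assms dvd_diff_right_iff[of l D "x\<^sup>2"]
    by (simp add: prime_dvd_power_iff dvd_diff_left_iff)
  then show ?thesis
    unfolding sqrt_count_def
    using sum_residues_linear[of l 1 0] prime_gt_0_int[OF assms(1)] by simp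
qed

text \<open>A solution with l | b and l | c would force l | x and then l^2 | D, so the last sum of
  \<open>tz_count_split\<close> vanishes. The modulus needs exponent at least 2 for this argument to
  see l^2.\<close>

lemma tz_count_exact_multiple:
  fixes l :: int
  assumes "prime l" "l dvd D" "\<not> l\<^sup>2 dvd D"
  shows "tz_count (l ^ (n + 2)) D = l ^ (2 * n + 2) * (l\<^sup>2 - 1)"
proof -
  have "\<not> l ^ Suc (Suc n) dvd x\<^sup>2 + l\<^sup>2 * (b * c) - D" for x b c
  proof
    assume "l ^ Suc (Suc n) dvd x\<^sup>2 + l\<^sup>2 * (b * c) - D"
    moreover have "l\<^sup>2 dvd l ^ Suc (Suc n)" by (intro le_imp_power_dvd) simp
    ultimately have *: "l\<^sup>2 dvd x\<^sup>2 + l\<^sup>2 * (b * c) - D" by (rule dvd_trans[rotated])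
    have "l dvd l\<^sup>2" by simp
    then have "l dvd x\<^sup>2 + l\<^sup>2 * (b * c) - D" using * by (rule dvd_trans)
    then have "l dvd (x\<^sup>2 + l\<^sup>2 * (b * c) - D) + D - l\<^sup>2 * (b * c)"
      using assms(2) \<open>l dvd l\<^sup>2\<close> by (metis dvd_add dvd_diff dvd_mult2)
    then have "l dvd x" using assms(1) prime_dvd_power by auto
    then have "l\<^sup>2 dvd x\<^sup>2" by simp
    then have "l\<^sup>2 dvd (x\<^sup>2 + l\<^sup>2 * (b * c)) - (x\<^sup>2 + l\<^sup>2 * (b * c) - D)"
      by (intro dvd_diff[OF _ *] dvd_add) auto
    then show False using assms(3) by simp
  qed
  then show ?thesis
    using tz_count_split[OF assms(1), of "Suc n" D] sqrt_count_multiple[OF assms(1,2)]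
    by (simp add: algebra_simps power2_eq_square power_add mult_2 mult_2_right)
qed

text \<open>In the last sum of \<open>tz_count_split\<close>, l divides x as well. Dividing the
  congruence by l^2 leaves the original equation for D modulo l^n, with each variable still running
  modulo l^(n+1); this accounts for the factor l^3.\<close>

lemma tz_count_square_multiple:
  fixes l :: int
  assumes "prime l"
  shows "tz_count (l ^ (n + 2)) (l\<^sup>2 * D)
    = l ^ (2 * n + 2) * (l\<^sup>2 - 1) + l ^ 3 * tz_count (l ^ n) D"
proof -
  have l0: "l > 0" using assms by (simp add: prime_gt_0_int)
  have M: "l ^ Suc n = l * l ^ n" by simp
  define M where "M = l ^ Suc n"
  have M0: "l ^ n > 0" "l \<ge> 0" using l0 by simp_all
  have dvd: "l ^ (n + 2) dvd (l * y)\<^sup>2 + l\<^sup>2 * (b * c) - l\<^sup>2 * D \<longleftrightarrow> l ^ n dvd y\<^sup>2 + b * c - D"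
    for y b c
  proof -
    have "(l * y)\<^sup>2 + l\<^sup>2 * (b * c) - l\<^sup>2 * D = l\<^sup>2 * (y\<^sup>2 + b * c - D)"
      by (simp add: algebra_simps power2_eq_square)
    moreover have "l ^ (n + 2) = l\<^sup>2 * l ^ n" by (simp only: power_add mult.commute)
    ultimately show ?thesis using l0 by (simp only:) simp
  qed
  have "of_bool (l ^ (n + 2) dvd x\<^sup>2 + l\<^sup>2 * (b * c) - l\<^sup>2 * D)
      = (of_bool (l dvd x) * of_bool (l ^ (n + 2) dvd x\<^sup>2 + l\<^sup>2 * (b * c) - l\<^sup>2 * D) :: int)" for x b c
  proof (cases "l ^ (n + 2) dvd x\<^sup>2 + l\<^sup>2 * (b * c) - l\<^sup>2 * D")
    case True
    moreover have "l dvd l ^ (n + 2)" by simp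
    ultimately have "l dvd x\<^sup>2 + l\<^sup>2 * (b * c) - l\<^sup>2 * D" by (rule dvd_trans[rotated])
    then have "l dvd x\<^sup>2 + l * (l * (b * c) - l * D)" by (simp add: algebra_simps power2_eq_square)
    then have "l dvd x\<^sup>2" by (simp add: dvd_add_left_iff)
    then have "l dvd x" using assms prime_dvd_power by blast
    then show ?thesis by simp
  qed simp
  then have "(\<Sum>x\<in>{0..<l ^ (n + 2)}. \<Sum>b\<in>{0..<M}. \<Sum>c\<in>{0..<M}.
           of_bool (l ^ (n + 2) dvd x\<^sup>2 + l\<^sup>2 * (b * c) - l\<^sup>2 * D) :: int)
     = (\<Sum>x\<in>{0..<l * M}. of_bool (l dvd x) * (\<Sum>b\<in>{0..<M}. \<Sum>c\<in>{0..<M}.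
           of_bool (l ^ (n + 2) dvd x\<^sup>2 + l\<^sup>2 * (b * c) - l\<^sup>2 * D)))"
    by (simp only: sum_distrib_left M_def power_Suc add_2_eq_Suc')
  also have "\<dots> = (\<Sum>y\<in>{0..<M}. \<Sum>b\<in>{0..<M}. \<Sum>c\<in>{0..<M}. of_bool (l ^ n dvd y\<^sup>2 + b * c - D))"
    by (simp only: sum_residues_multiples[OF l0] dvd)
  \<comment> \<open>The three ranges are shortened from l^(n+1) to l^n one after another, beginning
    with the innermost; each contributes a factor l.\<close>
  also have "\<dots> = (\<Sum>y\<in>{0..<M}. \<Sum>b\<in>{0..<M}. l * (\<Sum>c\<in>{0..<l ^ n}. of_bool (l ^ n dvd y\<^sup>2 + b * c - D)))"
    unfolding M_def M using M0
    by (intro sum.cong refl sum_residues_mult arg_cong[where f = of_bool] cong_dvd_iff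
        cong_diff cong_add cong_mult cong_refl) simp_all
  also have "\<dots> = (\<Sum>y\<in>{0..<M}. l * (\<Sum>b\<in>{0..<l ^ n}. l * (\<Sum>c\<in>{0..<l ^ n}. of_bool (l ^ n dvd y\<^sup>2 + b * c - D))))"
    unfolding M_def M using M0
    by (intro sum.cong refl sum_residues_mult arg_cong[where f = of_bool] arg_cong2[where f = "(*)"]
        cong_dvd_iff cong_diff cong_add cong_mult cong_refl) simp_all
  also have "\<dots> = l * (\<Sum>y\<in>{0..<l ^ n}. l * (\<Sum>b\<in>{0..<l ^ n}. l * (\<Sum>c\<in>{0..<l ^ n}. of_bool (l ^ n dvd y\<^sup>2 + b * c - D))))"
    unfolding M_def M using M0
    by (intro sum.cong refl sum_residues_mult arg_cong[where f = of_bool] arg_cong2[where f = "(*)"]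
        cong_dvd_iff cong_diff cong_add cong_mult cong_pow cong_refl) simp_all
  also have "\<dots> = l ^ 3 * tz_count (l ^ n) D"
    by (simp only: tz_count_def sum_distrib_left[symmetric] power3_eq_cube mult.assoc)
  finally show ?thesis
    using tz_count_split[OF assms(1), of "Suc n" "l\<^sup>2 * D"] sqrt_count_multiple[OF assms(1), of "l\<^sup>2 * D"]
    by (simp add: algebra_simps power2_eq_square power_add mult_2 mult_2_right M_def)
qed

text \<open>Writing the multiple as l D, the summand is the constant c^2 if l does not divide D, and
  (c + l^3 G)^2 with G a count modulo l^n if it does. Expanding the square gives the sum of squares
  two exponents lower, while the linear term is known from \<open>sum_tz_count\<close>.\<close>

lemma sum_tz_count_sq_multiples:
  fixes l :: int
  assumes "prime l"
  shows "(\<Sum>D\<in>{0..<l ^ (n + 2)}. of_bool (l dvd D) * (tz_count (l ^ (n + 2)) D)\<^sup>2)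
    = l ^ (5 * n + 5) * (l ^ 4 - 1) + l ^ 6 * (\<Sum>D\<in>{0..<l ^ n}. (tz_count (l ^ n) D)\<^sup>2)"
proof -
  define G where "G D = (tz_count (l ^ (n + 2)) D)\<^sup>2" for D
  define c where "c = l ^ (2 * n + 2) * (l\<^sup>2 - 1)"
  have l0: "l > 0" using assms by (simp add: prime_gt_0_int)
  have "(\<Sum>D\<in>{0..<l ^ (n + 2)}. of_bool (l dvd D) * G D) = (\<Sum>D\<in>{0..<l * l ^ n}. G (l * D))"
    using sum_residues_multiples[OF l0, where f = G] by simp
  also have "\<dots> = (\<Sum>D\<in>{0..<l * l ^ n}. of_bool (\<not> l dvd D) * G (l * D))
      + (\<Sum>D\<in>{0..<l * l ^ n}. of_bool (l dvd D) * G (l * D))"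
    by (rule sum_split_bool)
  also have "(\<Sum>D\<in>{0..<l * l ^ n}. of_bool (\<not> l dvd D) * G (l * D))
      = (\<Sum>D\<in>{0..<l * l ^ n}. of_bool (\<not> l dvd D) * c\<^sup>2)"
  proof (intro sum.cong refl)
    fix D
    show "of_bool (\<not> l dvd D) * G (l * D) = of_bool (\<not> l dvd D) * c\<^sup>2"
    proof (cases "l dvd D")
      case False
      then have "\<not> l\<^sup>2 dvd l * D" using l0 by (simp add: power2_eq_square)
      then show ?thesis
        using tz_count_exact_multiple[OF assms, of "l * D" n] by (simp add: G_def c_def)
    qed simp
  qed
  also have "\<dots> = (l * l ^ n - l ^ n) * c\<^sup>2"
    using sum_residues_coprime[OF l0, of "l ^ n"] l0 by (simp only: sum_distrib_right[symmetric]) simp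
  also have "(\<Sum>D\<in>{0..<l * l ^ n}. of_bool (l dvd D) * G (l * D))
      = (\<Sum>D\<in>{0..<l ^ n}. G (l * (l * D)))"
    by (rule sum_residues_multiples[OF l0])
  also have "\<dots> = (\<Sum>D\<in>{0..<l ^ n}. c\<^sup>2 + 2 * c * l ^ 3 * tz_count (l ^ n) D + l ^ 6 * (tz_count (l ^ n) D)\<^sup>2)"
  proof (intro sum.cong refl)
    fix D
    have "G (l * (l * D)) = (c + l ^ 3 * tz_count (l ^ n) D)\<^sup>2"
      using tz_count_square_multiple[OF assms, of n D]
      by (simp add: G_def c_def power2_eq_square mult.assoc)
    then show "G (l * (l * D)) = c\<^sup>2 + 2 * c * l ^ 3 * tz_count (l ^ n) D + l ^ 6 * (tz_count (l ^ n) D)\<^sup>2"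
      by (simp add: power2_sum power_mult_distrib flip: power_mult)
  qed
  also have "\<dots> = l ^ n * c\<^sup>2 + 2 * c * l ^ 3 * (l ^ n) ^ 3 + l ^ 6 * (\<Sum>D\<in>{0..<l ^ n}. (tz_count (l ^ n) D)\<^sup>2)"
    using sum_tz_count[of "l ^ n"] l0 by (simp add: sum.distrib flip: sum_distrib_left)
  finally have "(\<Sum>D\<in>{0..<l ^ (n + 2)}. of_bool (l dvd D) * G D)
     = (l * l ^ n * c\<^sup>2 + 2 * c * l ^ 3 * (l ^ n) ^ 3) + l ^ 6 * (\<Sum>D\<in>{0..<l ^ n}. (tz_count (l ^ n) D)\<^sup>2)"
    by (simp add: algebra_simps)
  also have "l * l ^ n * c\<^sup>2 + 2 * c * l ^ 3 * (l ^ n) ^ 3 = l ^ (5 * n + 5) * (l ^ 4 - 1)"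
  proof -
    \<comment> \<open>Replacing l^n by a free variable q makes the claim a polynomial identity in q
      and l. The same device is used in the later computations.\<close>
    have "c = (l ^ n) ^ 2 * l\<^sup>2 * (l\<^sup>2 - 1)" "l ^ (5 * n + 5) = (l ^ n) ^ 5 * l ^ 5"
      by (simp_all add: c_def power_add power2_eq_square mult.commute[of _ n] power_mult)
    moreover have "l * q * (q\<^sup>2 * l\<^sup>2 * (l\<^sup>2 - 1))\<^sup>2 + 2 * (q\<^sup>2 * l\<^sup>2 * (l\<^sup>2 - 1)) * l ^ 3 * q ^ 3
        = q ^ 5 * l ^ 5 * (l ^ 4 - 1)" for q
      by (simp add: eval_nat_numeral algebra_simps)
    ultimately show ?thesis by simp
  qed
  finally show ?thesis by (simp add: G_def)
qed

lemma sum_tz_count_sq_split: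
  fixes l :: int
  shows "(\<Sum>D\<in>A. (tz_count N D)\<^sup>2) = (\<Sum>D\<in>A. of_bool (\<not> l dvd D) * (tz_count N D)\<^sup>2)
     + (\<Sum>D\<in>A. of_bool (l dvd D) * (tz_count N D)\<^sup>2)"
  by (rule sum_split_bool)

lemma sum_tz_count_sq_1: "(\<Sum>D\<in>{0..<1}. (tz_count 1 D)\<^sup>2) = 1"
proof -
  have "{0..<1::int} = {0}" by auto
  then show ?thesis by (simp add: tz_count_def)
qed

text \<open>For n = 0 the last sum of \<open>tz_count_split\<close> has only the term b = c = 0,
  which is \<open>sqrt_count l D\<close> itself.\<close>

lemma tz_count_prime:
  fixes l :: int
  assumes "prime l"
  shows "tz_count l D = l * (l - 1) + l * sqrt_count l D"
proof -
  have "{0..<1::int} = {0}" by auto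
  then show ?thesis
    using tz_count_split[OF assms, of 0 D] by (simp add: sqrt_count_def algebra_simps)
qed

section \<open>Odd primes\<close>

lemma sum_sqrt_count:
  assumes "N > 0"
  shows "(\<Sum>D\<in>{0..<N}. sqrt_count N D) = N"
proof -
  have "(\<Sum>D\<in>{0..<N}. sqrt_count N D) = (\<Sum>x\<in>{0..<N}. \<Sum>D\<in>{0..<N}. of_bool (N dvd x\<^sup>2 - D))"
    unfolding sqrt_count_def by (rule sum.swap)
  also have "\<dots> = (\<Sum>x\<in>{0..<N}. 1)"
  proof (intro sum.cong refl)
    fix x
    show "(\<Sum>D\<in>{0..<N}. of_bool (N dvd x\<^sup>2 - D)) = (1::int)"
      using sum_residues_linear[OF assms, of "-1" "x\<^sup>2"] by simp
  qed
  finally show ?thesis using assms by simp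
qed

text \<open>Hensel lifting by a Newton step: the derivative 2 y at a root is a unit modulo l because
  neither 2 nor E is divisible by l.\<close>

lemma ex_root_lift:
  fixes l :: int
  assumes "prime l" "\<not> l dvd 2" "\<not> l dvd E" "l dvd x\<^sup>2 - E"
  shows "\<exists>y. l ^ Suc n dvd y\<^sup>2 - E"
proof (induction n)
  case 0
  then show ?case using assms by auto
next
  case (Suc n)
  then obtain y where y: "l ^ Suc n dvd y\<^sup>2 - E" by blast
  then obtain q where q: "y\<^sup>2 - E = l ^ Suc n * q" by blast
  have "\<not> l dvd y"
  proof
    assume "l dvd y"
    then have "l dvd y\<^sup>2 - (y\<^sup>2 - E)" unfolding q by (simp add: power2_eq_square)
    then show False using assms(3) by simp
  qed
  then have "\<not> l dvd 2 * y" using assms by (simp add: prime_dvd_mult_iff)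
  then have "coprime (2 * y) l" using prime_imp_coprime[OF assms(1)] coprime_commute by blast
  then obtain w where "[2 * y * w = 1] (mod l)" using cong_solve_coprime_int by blast
  then have "l dvd 2 * y * w - 1" by (simp add: cong_iff_dvd_diff)
  then have "l dvd q * (2 * y * w - 1)" by simp
  then have "l * l ^ Suc n dvd q * (2 * y * w - 1) * l ^ Suc n" by (rule mult_dvd_mono) simp
  moreover have "l * l ^ Suc n dvd l ^ Suc n * l ^ Suc n * (q * w)\<^sup>2" by (simp add: mult.assoc)
  \<comment> \<open>With w inverse to 2 y modulo l, the correction by l^(n+1) q w cancels the error
    l^(n+1) q up to a multiple of l^(n+2).\<close>
  moreover have "(y - l ^ Suc n * (q * w))\<^sup>2 - E
     = l ^ Suc n * l ^ Suc n * (q * w)\<^sup>2 - q * (2 * y * w - 1) * l ^ Suc n"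
  proof -
    have "(y - P * (q * w))\<^sup>2 - E = P * P * (q * w)\<^sup>2 - q * (2 * y * w - 1) * P + (y\<^sup>2 - E - P * q)" for P
      by (simp add: power2_eq_square algebra_simps)
    from this[of "l ^ Suc n"] show ?thesis unfolding q by simp
  qed
  ultimately have "l * l ^ Suc n dvd (y - l ^ Suc n * (q * w))\<^sup>2 - E" by (simp only: dvd_diff)
  then show ?case by (auto simp: mult.commute)
qed

text \<open>If r is a root, the modulus divides (x - r)(x + r). As l does not divide 2 r, one factor
  is coprime to l, so the modulus divides the other: the roots are exactly r and -r, which are
  distinct.\<close>

lemma sqrt_count_prime_power:
  fixes l :: int
  assumes l: "prime l" "\<not> l dvd 2" and E: "\<not> l dvd E"
  shows "sqrt_count (l ^ Suc n) E = (if \<exists>x. l dvd x\<^sup>2 - E then 2 else 0)"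
proof (cases "\<exists>x. l dvd x\<^sup>2 - E")
  case True
  define N where "N = l ^ Suc n"
  obtain r where r: "N dvd r\<^sup>2 - E" using ex_root_lift[OF l E] True by (auto simp: N_def)
  have lN: "l dvd N" by (simp add: N_def)
  have N0: "N > 0" using l by (simp add: N_def prime_gt_0_int)
  have "\<not> l dvd r"
  proof
    assume "l dvd r"
    then have "l dvd r\<^sup>2" by (simp add: power2_eq_square)
    moreover have "l dvd r\<^sup>2 - E" using r lN dvd_trans by blast
    ultimately have "l dvd r\<^sup>2 - (r\<^sup>2 - E)" by (rule dvd_diff)
    then show False using E by simp
  qed
  then have r2: "\<not> l dvd 2 * r" using l by (simp add: prime_dvd_mult_iff)
  have excl: "\<not> (l dvd x - r \<and> l dvd x + r)" for x
    using dvd_diff[of l "x + r" "x - r"] r2 by auto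
  have cop: "coprime a N" if "\<not> l dvd a" for a
    using that prime_imp_coprime[OF l(1)] by (simp add: N_def coprime_commute)
  \<comment> \<open>The terms are written as \<open>1 * x + - r\<close> and \<open>1 * x + r\<close>
    so that \<open>sum_residues_linear\<close> applies verbatim to each.\<close>
  have "of_bool (N dvd x\<^sup>2 - E) = (of_bool (N dvd 1 * x + - r) + of_bool (N dvd 1 * x + r) :: int)" for x
  proof -
    have "(x\<^sup>2 - E) - (r\<^sup>2 - E) = (x - r) * (x + r)" by (simp add: algebra_simps power2_eq_square)
    then have "N dvd x\<^sup>2 - E \<longleftrightarrow> N dvd (x - r) * (x + r)"
      using r by (metis dvd_diff_left_iff)
    also have "\<dots> \<longleftrightarrow> N dvd x - r \<or> N dvd x + r"
    proof
      assume *: "N dvd (x - r) * (x + r)"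
      show "N dvd x - r \<or> N dvd x + r"
      proof (cases "l dvd x + r")
        case True
        then have "coprime (x - r) N" using excl cop by blast
        then show ?thesis using * by (simp add: coprime_dvd_mult_right_iff coprime_commute)
      next
        case False
        then have "coprime (x + r) N" using cop by blast
        then show ?thesis using * by (simp add: coprime_dvd_mult_left_iff coprime_commute)
      qed
    qed auto
    moreover have "\<not> (N dvd x - r \<and> N dvd x + r)" using excl lN dvd_trans by blast
    ultimately show ?thesis by auto
  qed
  then have "sqrt_count N E = 1 + 1"
    unfolding sqrt_count_def
    by (simp only: sum.distrib sum_residues_linear[OF N0 coprime_1_left])
  then show ?thesis using True by (simp add: N_def)
next
  case False
  have "\<not> l ^ Suc n dvd x\<^sup>2 - E" for x
    using False dvd_trans[of l "l ^ Suc n"] by auto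
  then show ?thesis using False by (simp add: sqrt_count_def)
qed

lemma sqrt_count_prime:
  fixes l :: int
  assumes "prime l" "\<not> l dvd 2" "\<not> l dvd E"
  shows "sqrt_count l E = (if \<exists>x. l dvd x\<^sup>2 - E then 2 else 0)"
  using sqrt_count_prime_power[OF assms, of 0] by simp

text \<open>Moving the sum over x inside turns the remaining solutions into counts of square roots,
  which are known for units.\<close>

lemma tz_count_split_sqrt:
  fixes l :: int
  assumes "prime l"
  shows "tz_count (l ^ Suc n) D = l ^ Suc n * (l ^ Suc n - l ^ n)
      + (l ^ Suc n - l ^ n) * (l ^ n * sqrt_count l D)
      + (\<Sum>b\<in>{0..<l ^ n}. \<Sum>c\<in>{0..<l ^ n}. sqrt_count (l ^ Suc n) (D - l\<^sup>2 * (b * c)))"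
proof -
  have "(\<Sum>x\<in>{0..<l ^ Suc n}. \<Sum>b\<in>{0..<l ^ n}. \<Sum>c\<in>{0..<l ^ n}.
           of_bool (l ^ Suc n dvd x\<^sup>2 + l\<^sup>2 * (b * c) - D) :: int)
      = (\<Sum>b\<in>{0..<l ^ n}. \<Sum>x\<in>{0..<l ^ Suc n}. \<Sum>c\<in>{0..<l ^ n}.
           of_bool (l ^ Suc n dvd x\<^sup>2 + l\<^sup>2 * (b * c) - D))" by (rule sum.swap)
  also have "\<dots> = (\<Sum>b\<in>{0..<l ^ n}. \<Sum>c\<in>{0..<l ^ n}. \<Sum>x\<in>{0..<l ^ Suc n}.
           of_bool (l ^ Suc n dvd x\<^sup>2 + l\<^sup>2 * (b * c) - D))"
    by (intro sum.cong refl sum.swap)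
  also have "\<dots> = (\<Sum>b\<in>{0..<l ^ n}. \<Sum>c\<in>{0..<l ^ n}. sqrt_count (l ^ Suc n) (D - l\<^sup>2 * (b * c)))"
    by (simp add: sqrt_count_def algebra_simps)
  finally show ?thesis using tz_count_split[OF assms, of n D] by simp
qed

text \<open>Subtracting l^2 b c does not change D modulo l, and for odd l the number of roots of a
  unit depends only on its class modulo l. All l^(2 n) root counts are therefore equal.\<close>

lemma tz_count_unit:
  fixes l :: int
  assumes "prime l" "\<not> l dvd 2" "\<not> l dvd D"
  shows "tz_count (l ^ Suc n) D = l ^ (2 * n + 1) * (l - 1 + sqrt_count l D)"
proof -
  have "sqrt_count (l ^ Suc n) (D - l\<^sup>2 * y) = sqrt_count l D" for y
  proof -
    have "[D - l\<^sup>2 * y = D] (mod l)" by (simp add: cong_iff_dvd_diff)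
    moreover from this have "\<not> l dvd D - l\<^sup>2 * y" using assms(3) cong_dvd_iff by blast
    ultimately show ?thesis
      using sqrt_count_prime_power[OF assms(1,2)] sqrt_count_prime[OF assms(1,2)] sqrt_count_cong
      by metis
  qed
  moreover have "l > 0" using assms(1) by (simp add: prime_gt_0_int)
  ultimately have "(\<Sum>b\<in>{0..<l ^ n}. \<Sum>c\<in>{0..<l ^ n}. sqrt_count (l ^ Suc n) (D - l\<^sup>2 * (b * c)))
      = l ^ n * (l ^ n * sqrt_count l D)"
    by simp
  then show ?thesis
    using tz_count_split_sqrt[OF assms(1), of n D]
    by (simp add: algebra_simps power_add mult_2_right)
qed

text \<open>On units the root count s is 0 or 2, so s^2 = 2 s and the square of l - 1 + s is linear
  in s. Only the total of s over the units modulo l is then needed.\<close>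

lemma sum_tz_count_sq_units:
  fixes l :: int
  assumes "prime l" "\<not> l dvd 2"
  shows "(\<Sum>D\<in>{0..<l ^ Suc n}. of_bool (\<not> l dvd D) * (tz_count (l ^ Suc n) D)\<^sup>2)
    = l ^ (5 * n + 2) * (l - 1) * (l\<^sup>2 + 1)"
proof -
  have l0: "l > 0" using assms by (simp add: prime_gt_0_int)
  define c where "c = (l ^ (2 * n + 1))\<^sup>2"
  define h where "h D = of_bool (\<not> l dvd D) * (c * ((l - 1)\<^sup>2 + 2 * l * sqrt_count l D))" for D
  have "(\<Sum>D\<in>{0..<l ^ Suc n}. of_bool (\<not> l dvd D) * (tz_count (l ^ Suc n) D)\<^sup>2)
      = (\<Sum>D\<in>{0..<l ^ n * l}. h D)"
  proof (rule sum.cong)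
    fix D
    show "of_bool (\<not> l dvd D) * (tz_count (l ^ Suc n) D)\<^sup>2 = h D"
    proof (cases "l dvd D")
      case False
      then have "(sqrt_count l D)\<^sup>2 = 2 * sqrt_count l D"
        using sqrt_count_prime[OF assms] by auto
      then have "(l - 1 + sqrt_count l D)\<^sup>2 = (l - 1)\<^sup>2 + 2 * l * sqrt_count l D"
        by (simp add: power2_eq_square algebra_simps)
      then show ?thesis
        using False tz_count_unit[OF assms] by (simp add: h_def c_def power_mult_distrib)
    qed (simp add: h_def)
  qed (simp add: mult.commute)
  also have "\<dots> = l ^ n * (\<Sum>D\<in>{0..<l}. h D)"
  proof (rule sum_residues_mult)
    fix x y assume xy: "[x = y] (mod l)"
    then show "h x = h y" using sqrt_count_cong[OF xy] cong_dvd_iff[OF xy] by (simp add: h_def)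
  qed (use l0 in simp_all)
  also have "(\<Sum>D\<in>{0..<l}. h D) = c * ((l - 1)\<^sup>2 * (l - 1) + 2 * l * (l - 1))"
  proof -
    have "{0..<l} = insert 0 {1..<l}" using l0 by auto
    moreover have "(\<Sum>D\<in>{0..<l}. sqrt_count l D) = l" using sum_sqrt_count[OF l0] .
    moreover have "sqrt_count l 0 = 1" using sqrt_count_multiple[OF assms(1)] by simp
    \<comment> \<open>All root counts add up to l, and the class 0 contributes its single
      root.\<close>
    ultimately have "(\<Sum>D\<in>{1..<l}. sqrt_count l D) = l - 1" by simp
    moreover have "(\<Sum>D\<in>{0..<l}. h D) = (\<Sum>D\<in>{1..<l}. c * ((l - 1)\<^sup>2 + 2 * l * sqrt_count l D))"
    proof -
      have "(\<Sum>D\<in>{0..<l}. h D) = (\<Sum>D\<in>{1..<l}. h D)"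
        unfolding \<open>{0..<l} = insert 0 {1..<l}\<close> by (simp add: h_def)
      also have "\<dots> = (\<Sum>D\<in>{1..<l}. c * ((l - 1)\<^sup>2 + 2 * l * sqrt_count l D))"
        by (rule sum.cong) (auto simp: h_def dest: zdvd_imp_le)
      finally show ?thesis .
    qed
    moreover have "\<dots> = (l - 1) * (c * (l - 1)\<^sup>2) + c * (2 * l * (\<Sum>D\<in>{1..<l}. sqrt_count l D))"
      using l0 by (simp add: sum.distrib distrib_left sum_distrib_left mult.assoc)
    ultimately have "(\<Sum>D\<in>{0..<l}. h D) = (l - 1) * (c * (l - 1)\<^sup>2) + c * (2 * l * (l - 1))"
      by (simp only:)
    then show ?thesis by (simp add: algebra_simps)
  qed
  also have "l ^ n * (c * ((l - 1)\<^sup>2 * (l - 1) + 2 * l * (l - 1))) = l ^ (5 * n + 2) * (l - 1) * (l\<^sup>2 + 1)"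
  proof -
    have "c = ((l ^ n)\<^sup>2 * l)\<^sup>2" "l ^ (5 * n + 2) = (l ^ n) ^ 5 * l\<^sup>2"
      by (simp_all add: c_def power_add power2_eq_square mult.commute[of _ n] power_mult)
    moreover have "q * ((q\<^sup>2 * l)\<^sup>2 * ((l - 1)\<^sup>2 * (l - 1) + 2 * l * (l - 1)))
        = q ^ 5 * l\<^sup>2 * (l - 1) * (l\<^sup>2 + 1)" for q
      by (simp add: eval_nat_numeral algebra_simps)
    ultimately show ?thesis by simp
  qed
  finally show ?thesis .
qed

text \<open>The unit part and the multiples of l together give a recursion from exponent n to n + 2,
  started at exponents 0 and 1. The factor (l + 1) l clears denominators, so that the closed form is
  an integer identity.\<close>

lemma sum_tz_count_sq:
  fixes l :: int
  assumes "prime l" "\<not> l dvd 2"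
  shows "(l + 1) * l * (\<Sum>D\<in>{0..<l ^ n}. (tz_count (l ^ n) D)\<^sup>2) = l ^ (5 * n) * (l\<^sup>2 + l + 1) - l ^ (3 * n)"
proof (induction n rule: induct_nat_012)
  case 0
  show ?case using sum_tz_count_sq_1 by (simp add: algebra_simps power2_eq_square)
next
  case 1
  have l0: "l > 0" using assms by (simp add: prime_gt_0_int)
  have "(\<Sum>D\<in>{0..<l}. of_bool (l dvd D) * (tz_count l D)\<^sup>2) = (\<Sum>D\<in>{0..<1}. (tz_count l (l * D))\<^sup>2)"
    using sum_residues_multiples[OF l0, of "\<lambda>D. (tz_count l D)\<^sup>2" 1] by simp
  also have "\<dots> = (tz_count l 0)\<^sup>2"
  proof -
    have "{0..<1::int} = {0}" by auto
    then show ?thesis by simp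
  qed
  also have "\<dots> = (l\<^sup>2)\<^sup>2"
    using tz_count_prime[OF assms(1), of 0] sqrt_count_multiple[OF assms(1), of 0]
    by (simp add: algebra_simps power2_eq_square)
  finally have "(\<Sum>D\<in>{0..<l}. (tz_count l D)\<^sup>2) = l\<^sup>2 * (l - 1) * (l\<^sup>2 + 1) + (l\<^sup>2)\<^sup>2"
    using sum_tz_count_sq_split[of l "{0..<l}" l] sum_tz_count_sq_units[OF assms, of 0]
    by (simp add: power2_eq_square)
  moreover have "(l + 1) * l * (l\<^sup>2 * (l - 1) * (l\<^sup>2 + 1) + (l\<^sup>2)\<^sup>2) = l ^ 5 * (l\<^sup>2 + l + 1) - l ^ 3"
    by (simp add: eval_nat_numeral algebra_simps)
  ultimately show ?case by simp
next
  case (ge2 n)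
  define T where "T = (\<Sum>D\<in>{0..<l ^ n}. (tz_count (l ^ n) D)\<^sup>2)"
  define q where "q = l ^ n"
  have "(\<Sum>D\<in>{0..<l ^ (n + 2)}. (tz_count (l ^ (n + 2)) D)\<^sup>2)
     = l ^ (5 * n + 7) * (l - 1) * (l\<^sup>2 + 1) + (l ^ (5 * n + 5) * (l ^ 4 - 1) + l ^ 6 * T)"
    using sum_tz_count_sq_split[of "l ^ (n + 2)" "{0..<l ^ (n + 2)}" l]
      sum_tz_count_sq_units[OF assms, of "Suc n"] sum_tz_count_sq_multiples[OF assms(1), of n]
    by (simp add: T_def add.commute)
  moreover have "(l + 1) * l * T = q ^ 5 * (l\<^sup>2 + l + 1) - q ^ 3"
    using ge2(1) by (simp add: T_def q_def mult.commute[of _ n] power_mult)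
  moreover have "l ^ (5 * n + 7) = q ^ 5 * l ^ 7" "l ^ (5 * n + 5) = q ^ 5 * l ^ 5"
      "l ^ (5 * (n + 2)) = q ^ 5 * l ^ 10" "l ^ (3 * (n + 2)) = q ^ 3 * l ^ 6"
    by (simp_all add: q_def power_add mult.commute[of _ n] power_mult)
  \<comment> \<open>The sum is regrouped to isolate (l + 1) l T, the expression the induction
    hypothesis evaluates.\<close>
  moreover have "(l + 1) * l * (q ^ 5 * l ^ 7 * (l - 1) * (l\<^sup>2 + 1) + (q ^ 5 * l ^ 5 * (l ^ 4 - 1) + l ^ 6 * T))
      = (l + 1) * l * (q ^ 5 * l ^ 7 * (l - 1) * (l\<^sup>2 + 1) + q ^ 5 * l ^ 5 * (l ^ 4 - 1)) + l ^ 6 * ((l + 1) * l * T)"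
    by (simp only: distrib_left ac_simps)
  moreover have "(l + 1) * l * (q ^ 5 * l ^ 7 * (l - 1) * (l\<^sup>2 + 1) + q ^ 5 * l ^ 5 * (l ^ 4 - 1))
      + l ^ 6 * (q ^ 5 * (l\<^sup>2 + l + 1) - q ^ 3) = q ^ 5 * l ^ 10 * (l\<^sup>2 + l + 1) - q ^ 3 * l ^ 6"
    by (simp add: eval_nat_numeral algebra_simps)
  ultimately have "(l + 1) * l * (\<Sum>D\<in>{0..<l ^ (n + 2)}. (tz_count (l ^ (n + 2)) D)\<^sup>2)
      = l ^ (5 * (n + 2)) * (l\<^sup>2 + l + 1) - l ^ (3 * (n + 2))"
    by (simp only:)
  then show ?case by simp
qed

section \<open>Powers of two\<close>

lemma odd_square_mod_8:
  fixes x :: int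
  assumes "odd x"
  shows "8 dvd x\<^sup>2 - 1"
proof -
  obtain y where "x = 2 * y + 1" using assms by (elim oddE)
  then have "x\<^sup>2 - 1 = 4 * (y * (y + 1))" by (simp add: power2_eq_square algebra_simps)
  moreover have "4 * 2 dvd 4 * (y * (y + 1))" by (rule mult_dvd_mono) auto
  ultimately show ?thesis by simp
qed

text \<open>The derivative 2 y is never a unit modulo 2, so lifting starts at modulus 8 with the
  root 1 and corrects y by half the modulus.\<close>

lemma ex_root_lift_2:
  fixes E :: int
  assumes "8 dvd E - 1"
  shows "\<exists>y. 2 ^ (n + 3) dvd y\<^sup>2 - E"
proof (induction n)
  case 0
  have "2 ^ (0 + 3) dvd 1\<^sup>2 - E" using assms by (simp add: dvd_diff_commute)
  then show ?case by blast
next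
  case (Suc n)
  define M :: int where "M = 2 ^ (n + 2)"
  have two_M: "(2::int) ^ (n + 3) = 2 * M" by (simp add: M_def power_add)
  have four_M: "(2::int) ^ (Suc n + 3) = 4 * M" by (simp add: M_def power_add)
  obtain y q where q: "y\<^sup>2 - E = 2 * M * q" using Suc unfolding two_M by (auto elim!: dvdE)
  have "odd E" using assms by (elim dvdE) (auto simp: algebra_simps)
  moreover have "even (y\<^sup>2 - E)" unfolding q by simp
  ultimately have "odd y" by simp
  show ?case
  proof (cases "even q")
    case True
    then have "4 * M dvd y\<^sup>2 - E" unfolding q by (auto elim!: evenE)
    then show ?thesis unfolding four_M by (rule exI)
  next
    case False
    \<comment> \<open>Adding M replaces the odd quotient q by the even number q + y; the extra term
      M^2 is divisible by 4 M since 4 | M.\<close>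
    have "(y + M)\<^sup>2 - E = 2 * M * q + 2 * y * M + M * M"
      using q by (simp add: power2_eq_square algebra_simps)
    also have "\<dots> = 2 * M * (q + y) + M * M" by (simp add: algebra_simps)
    finally have *: "(y + M)\<^sup>2 - E = 2 * M * (q + y) + M * M" .
    have "2 * M * 2 dvd 2 * M * (q + y)" using False \<open>odd y\<close> by (intro mult_dvd_mono) auto
    moreover have "M * 4 dvd M * M" by (intro mult_dvd_mono) (auto simp: M_def)
    ultimately have "4 * M dvd (y + M)\<^sup>2 - E" unfolding * by (simp add: mult.commute)
    then show ?thesis unfolding four_M by (rule exI)
  qed
qed

text \<open>Relative to a root r, the roots are the x congruent to r or -r modulo half the modulus.
  These two classes are disjoint because r is odd and 4 divides the half modulus, and each has two
  lifts.\<close>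

lemma sqrt_count_power_2:
  fixes E :: int
  assumes "odd E"
  shows "sqrt_count (2 ^ (n + 3)) E = (if 8 dvd E - 1 then 4 else 0)"
proof (cases "8 dvd E - 1")
  case True
  define M :: int where "M = 2 ^ (n + 2)"
  have two_M: "(2::int) ^ (n + 3) = 2 * M" by (simp add: M_def power_add)
  obtain r where r: "2 * M dvd r\<^sup>2 - E" using ex_root_lift_2[OF True, of n] unfolding two_M by (elim exE)
  have M: "4 dvd M" "M > 0" by (simp_all add: M_def)
  have "even (r\<^sup>2 - E)" using r by (rule dvd_mult_left)
  then have odd: "odd r" using assms by simp
  have excl: "\<not> (M dvd x - r \<and> M dvd x + r)" for x
  proof
    assume "M dvd x - r \<and> M dvd x + r"
    then have "M dvd (x + r) - (x - r)" by (elim conjE) (rule dvd_diff)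
    then have "4 dvd (x + r) - (x - r)" using M(1) dvd_trans by blast
    then have "4 dvd 2 * r" by simp
    then show False using odd by presburger
  qed
  have "of_bool (2 * M dvd x\<^sup>2 - E) = (of_bool (M dvd 1 * x + - r) + of_bool (M dvd 1 * x + r) :: int)" for x
  proof -
    have "(x\<^sup>2 - E) - (r\<^sup>2 - E) = (x - r) * (x + r)" by (simp add: algebra_simps power2_eq_square)
    then have "2 * M dvd x\<^sup>2 - E \<longleftrightarrow> 2 * M dvd (x - r) * (x + r)"
      using r by (metis dvd_diff_left_iff)
    also have "\<dots> \<longleftrightarrow> M dvd x - r \<or> M dvd x + r"
    proof
      assume *: "2 * M dvd (x - r) * (x + r)"
      then have "even ((x - r) * (x + r))" by (rule dvd_mult_left)
      then have "even (x - r)" by auto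
      then obtain u where u: "x - r = 2 * u" by (elim evenE)
      then have v: "x + r = 2 * (u + r)" by simp
      have "M dvd u * (2 * (u + r))" using * unfolding u v by (simp add: mult.assoc)
      then have uM: "M dvd 2 * u * (u + r)" by (simp add: ac_simps)
      \<comment> \<open>Since r is odd, u and u + r have opposite parity; the odd one is coprime to
        the power of two M and can be cancelled.\<close>
      have cop: "coprime a M" if "odd a" for a using that by (simp only: M_def coprime_power_right_iff coprime_right_2_iff_odd simp_thms)
      show "M dvd x - r \<or> M dvd x + r"
      proof (cases "even u")
        case True
        then have "coprime (u + r) M" using odd cop by simp
        then have "M dvd 2 * u" using uM by (simp add: coprime_dvd_mult_left_iff coprime_commute)
        then show ?thesis using u by simp
      next
        case False
        then have "M dvd 2 * (u + r)" using uM cop[of u]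
          by (metis coprime_commute coprime_dvd_mult_right_iff mult.assoc mult.commute)
        then show ?thesis unfolding v by (rule disjI2)
      qed
    next
      have "even M" using M(1) by (auto elim!: dvdE)
      assume "M dvd x - r \<or> M dvd x + r"
      then show "2 * M dvd (x - r) * (x + r)"
      proof
        assume *: "M dvd x - r"
        then have "even (x - r)" using \<open>even M\<close> dvd_trans by blast
        then have "2 dvd x + r" by presburger
        with * have "M * 2 dvd (x - r) * (x + r)" by (rule mult_dvd_mono)
        then show ?thesis by (simp add: mult.commute)
      next
        assume *: "M dvd x + r"
        then have "even (x + r)" using \<open>even M\<close> dvd_trans by blast
        then have "2 dvd x - r" by presburger
        then show ?thesis using * by (rule mult_dvd_mono)
      qed
    qed
    finally show ?thesis using excl[of x] by auto
  qed
  then have "sqrt_count (2 * M) E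
      = (\<Sum>x\<in>{0..<2 * M}. of_bool (M dvd 1 * x + - r)) + (\<Sum>x\<in>{0..<2 * M}. of_bool (M dvd 1 * x + r))"
    unfolding sqrt_count_def by (simp only: sum.distrib)
  also have "\<dots> = 2 * (\<Sum>x\<in>{0..<M}. of_bool (M dvd 1 * x + - r)) + 2 * (\<Sum>x\<in>{0..<M}. of_bool (M dvd 1 * x + r))"
    using M(2) by (intro arg_cong2[where f = "(+)"] sum_residues_mult arg_cong[where f = of_bool]
        cong_dvd_iff cong_add cong_mult cong_refl) simp_all
  also have "\<dots> = 4"
    by (simp only: sum_residues_linear[OF M(2) coprime_1_left])
  finally show ?thesis using True by (simp only: two_M if_True)
next
  case False
  have "\<not> 2 ^ (n + 3) dvd x\<^sup>2 - E" for x
  proof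
    assume *: "2 ^ (n + 3) dvd x\<^sup>2 - E"
    have "(2::int) ^ 3 dvd 2 ^ (n + 3)" by (intro le_imp_power_dvd) simp
    then have 8: "8 dvd x\<^sup>2 - E" using dvd_trans[OF _ *] by simp
    then have "even (x\<^sup>2 - E)" by (rule dvd_trans[rotated]) simp
    then have "odd x" using assms by simp
    then have "8 dvd (x\<^sup>2 - 1) - (x\<^sup>2 - E)" using dvd_diff[OF odd_square_mod_8 8] by blast
    then show False using False by simp
  qed
  then show ?thesis using False by (simp add: sqrt_count_def)
qed

lemma sqrt_count_2: "sqrt_count 2 D = 1"
proof -
  have "{0..<2::int} = {0, 1}" by auto
  then show ?thesis by (simp add: sqrt_count_def del: sum_of_bool_eq)
qed

text \<open>Modulo 8, D - 4 b c is D if b c is even and D + 4 if it is odd. Hence four roots occur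
  for three quarters of the pairs (b, c) if D = 1 modulo 8, for one quarter if D = 5 modulo 8, and
  for none if D = 3 modulo 4; the middle branch of the formula is the class 5.\<close>

lemma tz_count_odd_2:
  assumes "odd D"
  shows "tz_count (2 ^ (n + 3)) D =
    2 ^ (2 * n + 4) * (if 8 dvd D - 1 then 6 else if 4 dvd D - 1 then 4 else 3)"
proof -
  define M :: int where "M = 2 ^ (n + 1)"
  have M0: "M > 0" by (simp add: M_def)
  have m: "(2::int) ^ (n + 2) = 2 * M" "(2::int) ^ Suc (n + 2) = 4 * M" "(2::int) ^ (n + 3) = 4 * M"
    by (simp_all add: M_def power_add)
  have two: "prime (2::int)" by simp
  have shift: "8 dvd D - 4 * z - 1 \<longleftrightarrow> (if even z then 8 dvd D - 1 else 8 dvd D - 5)" for z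
    by presburger
  have sc: "sqrt_count (2 ^ (n + 3)) (D - 2\<^sup>2 * (b * c))
     = (if 8 dvd D - 1 then 4 * (1 - of_bool (odd b) * of_bool (odd c))
        else if 4 dvd D - 1 then 4 * (of_bool (odd b) * of_bool (odd c)) else 0)" for b c
  proof -
    have "odd (D - 2\<^sup>2 * (b * c))" using assms by simp
    moreover have "8 dvd D - 2\<^sup>2 * (b * c) - 1 \<longleftrightarrow> (if even (b * c) then 8 dvd D - 1 else 8 dvd D - 5)"
      using shift[of "b * c"] by simp
    moreover have "4 dvd D - 1 \<longleftrightarrow> 8 dvd D - 1 \<or> 8 dvd D - 5" "\<not> (8 dvd D - 1 \<and> 8 dvd D - 5)"
      by presburger+
    ultimately show ?thesis using sqrt_count_power_2[of "D - 2\<^sup>2 * (b * c)" n] by auto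
  qed
  have odds: "(\<Sum>b\<in>{0..<2 * M}. of_bool (odd b) :: int) = M"
    using sum_residues_coprime[of 2 M] M0 by simp
  define g :: "int \<Rightarrow> int \<Rightarrow> int" where "g b c = of_bool (odd b) * of_bool (odd c)" for b c
  have g: "(\<Sum>b\<in>{0..<2 * M}. \<Sum>c\<in>{0..<2 * M}. g b c) = M * M"
    unfolding g_def by (simp only: sum_product[symmetric] odds)
  have "(\<Sum>b\<in>{0..<2 * M}. \<Sum>c\<in>{0..<2 * M}. 4 * (1 - g b c)) = 12 * M * M"
    unfolding sum_distrib_left[symmetric] sum_subtractf g using M0 by simp
  moreover have "(\<Sum>b\<in>{0..<2 * M}. \<Sum>c\<in>{0..<2 * M}. 4 * g b c) = 4 * M * M"
    unfolding sum_distrib_left[symmetric] g by simp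
  ultimately have "(\<Sum>b\<in>{0..<2 * M}. \<Sum>c\<in>{0..<2 * M}. sqrt_count (2 ^ (n + 3)) (D - 2\<^sup>2 * (b * c)))
     = (if 8 dvd D - 1 then 12 * M * M else if 4 dvd D - 1 then 4 * M * M else 0)"
    unfolding sc g_def[symmetric] by simp
  then have "tz_count (2 ^ (n + 3)) D = 4 * M * (4 * M - 2 * M) + (4 * M - 2 * M) * (2 * M)
     + (if 8 dvd D - 1 then 12 * M * M else if 4 dvd D - 1 then 4 * M * M else 0)"
    using tz_count_split_sqrt[OF two, of "n + 2" D] by (simp only: sqrt_count_2 m mult_1_right)
  moreover have "2 ^ (2 * n + 4) = 4 * (M * M)"
    by (simp add: M_def power_add power2_eq_square mult.commute[of 2 n] power_mult)
  moreover have "4 * M * (4 * M - 2 * M) + (4 * M - 2 * M) * (2 * M) = 12 * (M * M)" by simp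
  ultimately show ?thesis by (simp only: split: if_split) simp
qed

lemma sum_residues_8:
  fixes f :: "int \<Rightarrow> int"
  assumes "\<And>x y. [x = y] (mod 8) \<Longrightarrow> f x = f y"
  shows "(\<Sum>x\<in>{0..<2 ^ (n + 3)}. f x) = 2 ^ n * (f 0 + f 1 + f 2 + f 3 + f 4 + f 5 + f 6 + f 7)"
proof -
  have "(\<Sum>x\<in>{0..<2 ^ n * 8}. f x) = 2 ^ n * (\<Sum>x\<in>{0..<8}. f x)"
    by (rule sum_residues_mult[OF assms]) auto
  moreover have "{0..<8::int} = {0, 1, 2, 3, 4, 5, 6, 7}" by auto
  ultimately show ?thesis by (simp add: power_add)
qed

lemma sum_tz_count_sq_odd_2:
  "(\<Sum>D\<in>{0..<2 ^ (n + 3)}. of_bool (odd D) * (tz_count (2 ^ (n + 3)) D)\<^sup>2) = 35 * 2 ^ (5 * n + 9)"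
proof -
  define h :: "int \<Rightarrow> int" where "h D = of_bool (odd D) *
     (2 ^ (2 * n + 4) * (if 8 dvd D - 1 then 6 else if 4 dvd D - 1 then 4 else 3))\<^sup>2" for D
  have "(\<Sum>D\<in>{0..<2 ^ (n + 3)}. of_bool (odd D) * (tz_count (2 ^ (n + 3)) D)\<^sup>2)
      = (\<Sum>D\<in>{0..<2 ^ (n + 3)}. h D)"
  proof (intro sum.cong refl)
    fix D :: int
    show "of_bool (odd D) * (tz_count (2 ^ (n + 3)) D)\<^sup>2 = h D"
      by (cases "odd D") (simp_all add: h_def tz_count_odd_2)
  qed
  also have "\<dots> = 2 ^ n * (h 0 + h 1 + h 2 + h 3 + h 4 + h 5 + h 6 + h 7)"
  proof (rule sum_residues_8)
    fix x y :: int assume "[x = y] (mod 8)"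
    then have "odd x = odd y" "8 dvd x - 1 \<longleftrightarrow> 8 dvd y - 1" "4 dvd x - 1 \<longleftrightarrow> 4 dvd y - 1"
      unfolding cong_def by presburger+
    then show "h x = h y" by (simp add: h_def)
  qed
  also have "\<dots> = 35 * 2 ^ (5 * n + 9)"
  proof -
    \<comment> \<open>The four odd classes contribute 36 + 9 + 16 + 9 = 70, which yields the
      constant 35.\<close>
    have "h 0 = 0" "h 2 = 0" "h 4 = 0" "h 6 = 0"
      "h 1 = (2 ^ (2 * n + 4))\<^sup>2 * 36" "h 3 = (2 ^ (2 * n + 4))\<^sup>2 * 9"
      "h 5 = (2 ^ (2 * n + 4))\<^sup>2 * 16" "h 7 = (2 ^ (2 * n + 4))\<^sup>2 * 9"
      by (simp_all add: h_def power_mult_distrib)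
    moreover have "2 ^ (5 * n + 9) = (2 ^ n) ^ 5 * (512::int)" "2 ^ (2 * n + 4) = (2 ^ n) ^ 2 * (16::int)"
      by (simp_all add: power_add mult.commute[of _ n] power_mult)
    ultimately show ?thesis by (simp add: eval_nat_numeral)
  qed
  finally show ?thesis .
qed

lemma tz_count_2: "tz_count 2 D = 4"
  using tz_count_prime[of 2 D] by (simp add: sqrt_count_2)

text \<open>The odd part is known only from modulus 8 on, so the recursion starts from the moduli 2
  and 4, which are computed by hand. The factor 3 clears the denominator of the closed form.\<close>

lemma sum_tz_count_sq_2:
  "3 * (\<Sum>D\<in>{0..<2 ^ Suc n}. (tz_count (2 ^ Suc n) D)\<^sup>2) = 13 * 2 ^ (5 * n + 3) - 2 ^ (3 * n + 3)"
proof (induction n rule: induct_nat_012)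
  case 0
  have "{0..<2::int} = {0, 1}" by auto
  then show ?case by (simp add: tz_count_2)
next
  case 1
  have four: "{0..<4::int} = {0, 1, 2, 3}" and two: "{0..<2::int} = {0, 1}" by auto
  have "tz_count 4 1 = 20" "tz_count 4 3 = 12"
    using tz_count_split_sqrt[of 2 1 1] tz_count_split_sqrt[of 2 1 3]
    by (simp_all add: sqrt_count_2 two sqrt_count_def four del: sum_of_bool_eq)
  then have "(\<Sum>D\<in>{0..<4}. of_bool (odd D) * (tz_count 4 D)\<^sup>2) = 544"
    by (simp add: four)
  \<comment> \<open>The recursion is applied here with the trivial modulus 1 as its lower
    level.\<close>
  moreover have "(\<Sum>D\<in>{0..<4}. of_bool (even D) * (tz_count 4 D)\<^sup>2) = 544"
    using sum_tz_count_sq_multiples[of 2 0] sum_tz_count_sq_1 by simp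
  ultimately have "(\<Sum>D\<in>{0..<4}. (tz_count 4 D)\<^sup>2) = 1088"
    using sum_tz_count_sq_split[of 4 "{0..<4}" 2] by simp
  then show ?case by simp
next
  case (ge2 n)
  define T where "T = (\<Sum>D\<in>{0..<2 ^ Suc n}. (tz_count (2 ^ Suc n) D)\<^sup>2)"
  define q :: int where "q = 2 ^ n"
  have "(\<Sum>D\<in>{0..<2 ^ (n + 3)}. (tz_count (2 ^ (n + 3)) D)\<^sup>2)
     = 35 * 2 ^ (5 * n + 9) + (2 ^ (5 * n + 10) * 15 + 64 * T)"
    using sum_tz_count_sq_split[of "2 ^ (n + 3)" "{0..<2 ^ (n + 3)}" 2]
      sum_tz_count_sq_odd_2[of n] sum_tz_count_sq_multiples[of 2 "Suc n"]
    by (simp add: T_def numeral_3_eq_3)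
  moreover have "3 * T = 13 * (8 * q ^ 5) - 8 * q ^ 3"
    using ge2(1) by (simp add: T_def q_def power_add mult.commute[of _ n] power_mult)
  moreover have "2 ^ (5 * n + 9) = 512 * q ^ 5" "2 ^ (5 * n + 10) = 1024 * q ^ 5"
      "2 ^ (5 * (n + 2) + 3) = 8192 * q ^ 5" "2 ^ (3 * (n + 2) + 3) = 512 * q ^ 3"
    by (simp_all add: q_def power_add mult.commute[of _ n] power_mult)
  ultimately have "3 * (\<Sum>D\<in>{0..<2 ^ (n + 3)}. (tz_count (2 ^ (n + 3)) D)\<^sup>2)
      = 13 * 2 ^ (5 * (n + 2) + 3) - 2 ^ (3 * (n + 2) + 3)"
    by simp
  then show ?case by (simp add: numeral_3_eq_3)
qed

section \<open>Counting matrices\<close>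

lemma card_eq_sum_of_bool:
  "finite A \<Longrightarrow> int (card {x \<in> A. P x}) = (\<Sum>x\<in>A. of_bool (P x))"
  by (simp add: Int_def)

lemma mat_count_eq_sum:
  assumes N: "N > 0"
  shows "int (mat_count t u N) = (\<Sum>a\<in>{0..<N}. \<Sum>b\<in>{0..<N}. \<Sum>c\<in>{0..<N}.
      of_bool (N dvd a * (t - a) - b * c - u))"
proof -
  define X where "X = {0..<N} \<times> {0..<N} \<times> {0..<N}"
  define M where "M = {A :: int^2^2. (\<forall>i j. A $ i $ j \<in> carrier (residue_ring N)) \<and>
                         [trace A = t] (mod N) \<and> [det A = u] (mod N)}"
  \<comment> \<open>The trace determines the lower right entry; reducing it modulo \<open>N\<close>
    selects its representative in the carrier.\<close>
  define mk :: "int \<times> int \<times> int \<Rightarrow> int^2^2" where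
    "mk = (\<lambda>(a, b, c). \<chi> i j. if i = 1 then (if j = 1 then a else b)
       else (if j = 1 then c else (t - a) mod N))"
  have mk: "mk (a, b, c) $ 1 $ 1 = a" "mk (a, b, c) $ 1 $ 2 = b"
    "mk (a, b, c) $ 2 $ 1 = c" "mk (a, b, c) $ 2 $ 2 = (t - a) mod N" for a b c
    by (simp_all add: mk_def)
  have carrier: "carrier (residue_ring N) = {0..<N}" by (auto simp: residue_ring_def)
  have "bij_betw mk {(a, b, c) \<in> X. N dvd a * (t - a) - b * c - u} M"
  proof (rule bij_betw_byWitness[where f' = "\<lambda>A. (A $ 1 $ 1, A $ 1 $ 2, A $ 2 $ 1)"])
    show "\<forall>p\<in>{(a, b, c) \<in> X. N dvd a * (t - a) - b * c - u}.
        (mk p $ 1 $ 1, mk p $ 1 $ 2, mk p $ 2 $ 1) = p"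
      by (auto simp: mk)
    show "\<forall>A\<in>M. mk (A $ 1 $ 1, A $ 1 $ 2, A $ 2 $ 1) = A"
    proof
      fix A assume A: "A \<in> M"
      then have 22: "A $ 2 $ 2 \<in> {0..<N}"
        and "[A $ 1 $ 1 + A $ 2 $ 2 = t] (mod N)"
        by (auto simp: M_def trace_def sum_2 carrier)
      then have "[A $ 2 $ 2 = t - A $ 1 $ 1] (mod N)"
        by (metis add_diff_cancel_left' cong_diff cong_refl)
      then have "(t - A $ 1 $ 1) mod N = A $ 2 $ 2" using 22 by (simp add: cong_def)
      then show "mk (A $ 1 $ 1, A $ 1 $ 2, A $ 2 $ 1) = A"
        by (simp add: vec_eq_iff forall_2 mk)
    qed
    show "mk ` {(a, b, c) \<in> X. N dvd a * (t - a) - b * c - u} \<subseteq> M"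
    proof (clarsimp simp: X_def)
      fix a b c
      assume abc: "0 \<le> a" "a < N" "0 \<le> b" "b < N" "0 \<le> c" "c < N"
        and dvd: "N dvd a * (t - a) - b * c - u"
      have "[a + (t - a) mod N = a + (t - a)] (mod N)"
        by (intro cong_add cong_refl) (simp add: cong_def)
      moreover have "[a * ((t - a) mod N) - b * c = a * (t - a) - b * c] (mod N)"
        by (intro cong_diff cong_mult cong_refl) (simp add: cong_def)
      moreover have "[a * (t - a) - b * c = u] (mod N)" using dvd by (simp add: cong_iff_dvd_diff)
      ultimately show "mk (a, b, c) \<in> M"
        using N abc by (auto simp: M_def carrier trace_def sum_2 det_2 forall_2 mk intro: cong_trans)
    qed
    show "(\<lambda>A. (A $ 1 $ 1, A $ 1 $ 2, A $ 2 $ 1)) ` M \<subseteq> {(a, b, c) \<in> X. N dvd a * (t - a) - b * c - u}"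
    proof (rule image_subsetI)
      fix A assume A: "A \<in> M"
      then have "[A $ 1 $ 1 + A $ 2 $ 2 = t] (mod N)" "[A $ 1 $ 1 * A $ 2 $ 2 - A $ 1 $ 2 * A $ 2 $ 1 = u] (mod N)"
        and A': "A $ i $ j \<in> {0..<N}" for i j
        by (auto simp: M_def trace_def sum_2 det_2 carrier)
      then have "[A $ 2 $ 2 = t - A $ 1 $ 1] (mod N)"
        by (metis add_diff_cancel_left' cong_diff cong_refl)
      then have "[A $ 1 $ 1 * A $ 2 $ 2 - A $ 1 $ 2 * A $ 2 $ 1
          = A $ 1 $ 1 * (t - A $ 1 $ 1) - A $ 1 $ 2 * A $ 2 $ 1] (mod N)"
        by (intro cong_diff cong_mult cong_refl)
      then have "[A $ 1 $ 1 * (t - A $ 1 $ 1) - A $ 1 $ 2 * A $ 2 $ 1 = u] (mod N)"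
        using \<open>[A $ 1 $ 1 * A $ 2 $ 2 - A $ 1 $ 2 * A $ 2 $ 1 = u] (mod N)\<close> cong_sym cong_trans by blast
      then show "(A $ 1 $ 1, A $ 1 $ 2, A $ 2 $ 1) \<in> {(a, b, c) \<in> X. N dvd a * (t - a) - b * c - u}"
        using A' by (simp add: X_def cong_iff_dvd_diff)
    qed
  qed
  then have "mat_count t u N = card {(a, b, c) \<in> X. N dvd a * (t - a) - b * c - u}"
    by (simp add: mat_count_def M_def bij_betw_same_card)
  also have "\<dots> = card {p \<in> X. case p of (a, b, c) \<Rightarrow> N dvd a * (t - a) - b * c - u}"
    by (rule arg_cong[where f = card]) auto
  finally have "int (mat_count t u N) = (\<Sum>p\<in>X. of_bool (case p of (a, b, c) \<Rightarrow> N dvd a * (t - a) - b * c - u))"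
    by (simp only: card_eq_sum_of_bool X_def finite_cartesian_product finite_atLeastLessThan_int)
  also have "\<dots> = (\<Sum>(a, b, c)\<in>X. of_bool (N dvd a * (t - a) - b * c - u))"
    by (rule sum.cong) auto
  finally show ?thesis by (simp only: X_def sum.cartesian_product)
qed

text \<open>Completing the square: for a = x + h and t = 2 h, the product a (t - a) equals h^2 -
  x^2.\<close>

lemma mat_count_eq_tz_count:
  assumes "N > 0" and t: "[t = 2 * h] (mod N)"
  shows "int (mat_count t u N) = tz_count N (h\<^sup>2 - u)"
proof -
  define f :: "int \<Rightarrow> int" where
    "f a = (\<Sum>b\<in>{0..<N}. \<Sum>c\<in>{0..<N}. of_bool (N dvd a * (t - a) - b * c - u))" for a
  have "(\<Sum>x\<in>{0..<N}. f (1 * x + h)) = (\<Sum>a\<in>{0..<N}. f a)"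
  proof (rule sum_residues_affine)
    fix x y :: int assume xy: "[x = y] (mod N)"
    then show "f x = f y"
      unfolding f_def by (intro sum.cong refl arg_cong[where f = of_bool] cong_dvd_iff cong_diff cong_mult cong_refl)
  qed (use assms in auto)
  moreover have "N dvd (x + h) * (t - (x + h)) - b * c - u \<longleftrightarrow> N dvd x\<^sup>2 + b * c - (h\<^sup>2 - u)" for x b c
  proof -
    have "[(x + h) * (t - (x + h)) - b * c - u = (x + h) * (2 * h - (x + h)) - b * c - u] (mod N)"
      using t by (intro cong_diff cong_mult cong_refl)
    also have "(x + h) * (2 * h - (x + h)) - b * c - u = - (x\<^sup>2 + b * c - (h\<^sup>2 - u))"
      by (simp add: power2_eq_square algebra_simps)
    finally show ?thesis using cong_dvd_iff dvd_minus_iff by blast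
  qed
  ultimately show ?thesis
    using mat_count_eq_sum[OF assms(1), of t u] by (simp add: tz_count_def f_def)
qed

lemma S_eq_sum:
  fixes l :: int
  assumes "prime l"
  shows "int (S t (l ^ Suc n)) = (\<Sum>u\<in>{0..<l ^ Suc n}. of_bool (\<not> l dvd u) * (int (mat_count t u (l ^ Suc n)))\<^sup>2)"
proof -
  define N where "N = l ^ Suc n"
  have "l > 1" using assms by (simp add: prime_gt_1_int)
  then have "N > 1" unfolding N_def by (intro one_less_power) auto
  then interpret residues N "residue_ring N" by unfold_locales simp_all
  have "coprime u N \<longleftrightarrow> \<not> l dvd u" for u
    using prime_imp_coprime[OF assms, of u] not_coprimeI[of l u l] \<open>l > 1\<close>
    by (auto simp: N_def coprime_commute)
  \<comment> \<open>Coprimality to a prime power is tested by l alone. The residue 0 may stay in the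
    range because l divides it.\<close>
  then have "Units (residue_ring N) = {u \<in> {0..<N}. \<not> l dvd u}"
    using res_units_eq by (auto simp: order_le_less)
  then have "int (S t N) = (\<Sum>u\<in>{u \<in> {0..<N}. \<not> l dvd u}. (int (mat_count t u N))\<^sup>2)"
    by (simp add: S_def)
  also have "\<dots> = (\<Sum>u\<in>{0..<N}. of_bool (\<not> l dvd u) * (int (mat_count t u N))\<^sup>2)"
    unfolding sum.inter_filter[OF finite_atLeastLessThan_int] by (rule sum.cong) auto
  finally show ?thesis by (simp only: N_def)
qed

text \<open>The reflection D = h^2 - u permutes the residues and carries the unit condition on u to
  the condition on h^2 - D.\<close>

lemma S_eq_sum_tz_count:
  fixes l :: int
  assumes "prime l" and t: "[t = 2 * h] (mod l ^ Suc n)"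
  shows "int (S t (l ^ Suc n)) =
    (\<Sum>D\<in>{0..<l ^ Suc n}. of_bool (\<not> l dvd h\<^sup>2 - D) * (tz_count (l ^ Suc n) D)\<^sup>2)"
proof -
  define N where "N = l ^ Suc n"
  have N0: "N > 0" using assms by (simp add: N_def prime_gt_0_int)
  define f where "f D = of_bool (\<not> l dvd h\<^sup>2 - D) * (tz_count N D)\<^sup>2" for D
  have "(\<Sum>u\<in>{0..<N}. f (- 1 * u + h\<^sup>2)) = (\<Sum>D\<in>{0..<N}. f D)"
  proof (rule sum_residues_affine)
    fix x y assume xy: "[x = y] (mod N)"
    then have "[x = y] (mod l)" by (rule cong_dvd_modulus) (simp add: N_def)
    then have "l dvd h\<^sup>2 - x \<longleftrightarrow> l dvd h\<^sup>2 - y" by (intro cong_dvd_iff cong_diff cong_refl)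
    then show "f x = f y" using tz_count_cong[OF xy] by (simp add: f_def)
  qed (use N0 in auto)
  then show ?thesis
    using S_eq_sum[OF assms(1), of t n] mat_count_eq_tz_count[OF N0 t[folded N_def]]
    by (simp add: f_def N_def)
qed

section \<open>Evaluation of S for odd primes\<close>

lemma ex_half_mod:
  fixes l :: int
  assumes "prime l" "\<not> l dvd 2"
  shows "\<exists>h. [t = 2 * h] (mod l ^ n)"
proof -
  have "coprime 2 (l ^ n)" using prime_imp_coprime[OF assms] by (simp add: coprime_commute)
  then obtain w where "[2 * w = 1] (mod l ^ n)" using cong_solve_coprime_int by blast
  then have "[2 * w * t = 1 * t] (mod l ^ n)" by (intro cong_mult cong_refl)
  then show ?thesis by (auto simp: mult.assoc cong_sym_eq)
qed

lemma S_odd_dvd: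
  fixes l :: int
  assumes l: "prime l" "\<not> l dvd 2" and "l dvd t"
  shows "int (S t (l ^ Suc n)) = l ^ (5 * n) * (l\<^sup>2 * (l\<^sup>2 + 1) * (l - 1))"
proof -
  obtain h where h: "[t = 2 * h] (mod l ^ Suc n)" using ex_half_mod[OF l] by blast
  then have "[t = 2 * h] (mod l)" by (rule cong_dvd_modulus) simp
  then have "l dvd 2 * h" using \<open>l dvd t\<close> cong_dvd_iff by blast
  then have "l dvd h\<^sup>2" using l by (simp add: prime_dvd_mult_iff power2_eq_square)
  then have "l dvd h\<^sup>2 - D \<longleftrightarrow> l dvd D" for D by (simp add: dvd_diff_right_iff)
  then have "int (S t (l ^ Suc n)) = l ^ (5 * n + 2) * (l - 1) * (l\<^sup>2 + 1)"
    using S_eq_sum_tz_count[OF l(1) h] sum_tz_count_sq_units[OF l] by (simp only:)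
  then show ?thesis by (simp only: power_add) (simp only: ac_simps)
qed

text \<open>From the full sum of squares the class D = h^2 modulo l is removed. Its l^n members are
  units with the root h modulo l, hence with two roots, so the count on them is constant.\<close>

lemma S_odd_not_dvd:
  fixes l :: int
  assumes l: "prime l" and t: "\<not> l dvd 2 * t"
  shows "(l + 1) * int (S t (l ^ Suc n)) = l ^ (5 * n + 2) * (l ^ 4 - 2 * l\<^sup>2 - 3 * l - 1) - l ^ (3 * n + 2)"
proof -
  have l2: "\<not> l dvd 2" and "\<not> l dvd t" using t by auto
  have l0: "l > 0" using l by (simp add: prime_gt_0_int)
  define N where "N = l ^ Suc n"
  define q where "q = l ^ n"
  obtain h where h: "[t = 2 * h] (mod l ^ Suc n)" using ex_half_mod[OF l l2] by blast
  then have "[t = 2 * h] (mod l)" by (rule cong_dvd_modulus) simp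
  then have "\<not> l dvd 2 * h" using \<open>\<not> l dvd t\<close> cong_dvd_iff by blast
  then have h2: "\<not> l dvd h\<^sup>2" using prime_dvd_power[OF l] by auto
  define G where "G D = (tz_count N D)\<^sup>2" for D
  have "(\<Sum>D\<in>{0..<N}. of_bool (l dvd h\<^sup>2 - D) * G D)
      = (\<Sum>D\<in>{0..<N}. of_bool (l dvd h\<^sup>2 - D) * (l ^ (2 * n + 1) * (l + 1))\<^sup>2)"
  proof (intro sum.cong refl)
    fix D
    show "of_bool (l dvd h\<^sup>2 - D) * G D = of_bool (l dvd h\<^sup>2 - D) * (l ^ (2 * n + 1) * (l + 1))\<^sup>2"
    proof (cases "l dvd h\<^sup>2 - D")
      case True
      then have "\<not> l dvd D" using h2 dvd_add[of l "h\<^sup>2 - D" D] by auto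
      moreover have "l dvd h\<^sup>2 - D" using True .
      ultimately have "sqrt_count l D = 2" using sqrt_count_prime[OF l l2, of D] by auto
      moreover have "l - 1 + 2 = l + 1" by simp
      ultimately show ?thesis
        using tz_count_unit[OF l l2 \<open>\<not> l dvd D\<close>, of n] by (simp only: G_def N_def)
    qed simp
  qed
  also have "\<dots> = (\<Sum>D\<in>{0..<l ^ n * l}. of_bool (l dvd h\<^sup>2 - D)) * (l ^ (2 * n + 1) * (l + 1))\<^sup>2"
    by (simp only: sum_distrib_right N_def power_Suc mult.commute[of l "l ^ n"])
  also have "(\<Sum>D\<in>{0..<l ^ n * l}. of_bool (l dvd h\<^sup>2 - D) :: int)
      = l ^ n * (\<Sum>D\<in>{0..<l}. of_bool (l dvd h\<^sup>2 - D))"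
    using l0 by (intro sum_residues_mult arg_cong[where f = of_bool] cong_dvd_iff cong_diff cong_refl) simp_all
  also have "(\<Sum>D\<in>{0..<l}. of_bool (l dvd h\<^sup>2 - D) :: int) = 1"
    using sum_residues_linear[OF l0, of "-1" "h\<^sup>2"] by simp
  finally have "(\<Sum>D\<in>{0..<N}. of_bool (l dvd h\<^sup>2 - D) * G D) = l ^ n * 1 * (l ^ (2 * n + 1) * (l + 1))\<^sup>2" .
  moreover have "int (S t N) = (\<Sum>D\<in>{0..<N}. of_bool (\<not> l dvd h\<^sup>2 - D) * G D)"
    using S_eq_sum_tz_count[OF l h] by (simp only: N_def G_def)
  moreover have "(\<Sum>D\<in>{0..<N}. G D) = (\<Sum>D\<in>{0..<N}. of_bool (\<not> l dvd h\<^sup>2 - D) * G D)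
      + (\<Sum>D\<in>{0..<N}. of_bool (l dvd h\<^sup>2 - D) * G D)"
    by (rule sum_split_bool)
  moreover have "l ^ (2 * n + 1) = q\<^sup>2 * l"
    by (simp add: q_def mult.commute[of _ n] power_mult)
  ultimately have S: "int (S t N) = (\<Sum>D\<in>{0..<N}. G D) - q * (q\<^sup>2 * l * (l + 1))\<^sup>2"
    by (simp only: q_def[symmetric] mult_1_right add_diff_cancel_right')
  have T: "(l + 1) * l * (\<Sum>D\<in>{0..<N}. G D) = q ^ 5 * l ^ 5 * (l\<^sup>2 + l + 1) - q ^ 3 * l ^ 3"
    using sum_tz_count_sq[OF l l2, of "Suc n"]
    by (simp add: G_def N_def q_def power_add mult.commute[of _ n] power_mult flip: power_Suc)
  \<comment> \<open>The additional factor l matches the left side of \<open>sum_tz_count_sq\<close>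
    and is cancelled at the end.\<close>
  have "l * ((l + 1) * int (S t N)) = (l + 1) * l * (\<Sum>D\<in>{0..<N}. G D) - (l + 1) * l * (q * (q\<^sup>2 * l * (l + 1))\<^sup>2)"
    unfolding S by (simp add: algebra_simps)
  also have "\<dots> = l * (q ^ 5 * l\<^sup>2 * (l ^ 4 - 2 * l\<^sup>2 - 3 * l - 1) - q ^ 3 * l\<^sup>2)"
    unfolding T by (simp add: eval_nat_numeral algebra_simps)
  finally have "(l + 1) * int (S t N) = q ^ 5 * l\<^sup>2 * (l ^ 4 - 2 * l\<^sup>2 - 3 * l - 1) - q ^ 3 * l\<^sup>2"
    using l0 by simp
  moreover have "l ^ (5 * n + 2) = q ^ 5 * l\<^sup>2" "l ^ (3 * n + 2) = q ^ 3 * l\<^sup>2"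
    by (simp_all add: q_def power_add power2_eq_square mult.commute[of _ n] power_mult)
  ultimately show ?thesis by (simp only: N_def)
qed

section \<open>Evaluation of S for powers of two\<close>

text \<open>An odd trace cannot be halved, but a (t - a) is then always even. So b c must be odd:
  every a and every odd b are allowed, and c is determined by them.\<close>

lemma mat_count_2_odd:
  assumes "odd t" "odd u"
  shows "int (mat_count t u (2 ^ Suc n)) = 2 ^ (2 * n + 1)"
proof -
  define N :: int where "N = 2 ^ Suc n"
  have N0: "N > 0" by (simp add: N_def)
  have "(\<Sum>b\<in>{0..<N}. \<Sum>c\<in>{0..<N}. of_bool (N dvd a * (t - a) - b * c - u)) = (2 ^ n :: int)" for a
  proof -
    have odd: "odd (a * (t - a) - u)" using assms by auto
    have swap: "a * (t - a) - b * c - u = - b * c + (a * (t - a) - u)" for b c by simp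
    have "(\<Sum>c\<in>{0..<N}. of_bool (N dvd a * (t - a) - b * c - u)) = (of_bool (odd b) :: int)" for b
    proof (cases "odd b")
      case True
      then have "coprime b N"
        by (simp only: N_def coprime_power_right_iff coprime_right_2_iff_odd simp_thms)
      then have "coprime (- b) N" by simp
      then show ?thesis
        unfolding swap using True by (simp only: sum_residues_linear[OF N0] of_bool_eq simp_thms)
    next
      case False
      have "\<not> N dvd a * (t - a) - b * c - u" for c
      proof
        assume "N dvd a * (t - a) - b * c - u"
        moreover have "even N" by (simp add: N_def)
        ultimately have "even (a * (t - a) - b * c - u)" by (rule dvd_trans[rotated])
        then show False using odd False by simp
      qed
      then show ?thesis using False by simp
    qed
    then show ?thesis using sum_residues_coprime[of 2 "2 ^ n"] by (simp add: N_def)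
  qed
  then have "int (mat_count t u N) = N * 2 ^ n"
    using mat_count_eq_sum[OF N0, of t u] N0 by simp
  then show ?thesis
    by (simp add: N_def power_mult power2_eq_square mult.commute[of 2 n])
qed

lemma S_2_odd:
  assumes "odd t"
  shows "int (S t (2 ^ Suc n)) = 4 * 2 ^ (5 * n)"
proof -
  have "int (S t (2 ^ Suc n)) = (\<Sum>u\<in>{0..<2 ^ Suc n}. of_bool (odd u) * (int (mat_count t u (2 ^ Suc n)))\<^sup>2)"
    by (rule S_eq_sum) simp
  also have "\<dots> = (\<Sum>u\<in>{0..<2 * 2 ^ n :: int}. of_bool (odd u) * (2 ^ (2 * n + 1))\<^sup>2)"
  proof (rule sum.cong)
    fix u :: int
    show "of_bool (odd u) * (int (mat_count t u (2 ^ Suc n)))\<^sup>2 = of_bool (odd u) * (2 ^ (2 * n + 1))\<^sup>2"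
      using mat_count_2_odd[OF assms, of u n] by (cases "odd u") simp_all
  qed simp
  also have "\<dots> = 2 ^ n * (2 ^ (2 * n + 1))\<^sup>2"
    using sum_residues_coprime[of 2 "2 ^ n"] by (simp only: sum_distrib_right[symmetric]) simp
  also have "\<dots> = 4 * 2 ^ (5 * n)"
    by (simp add: power_add power2_eq_square mult.commute[of _ n] power_mult power_mult_distrib eval_nat_numeral)
  finally show ?thesis .
qed

text \<open>Half of t is even, so u is odd exactly if D is, and the sum is the odd part already
  computed.\<close>

lemma S_2_dvd_4:
  assumes "4 dvd t"
  shows "int (S t (2 ^ (n + 3))) = 35 * 2 ^ (5 * n + 9)"
proof -
  obtain h where h: "t = 2 * (2 * h)" using assms by (elim dvdE) simp
  have "prime (2::int)" by simp
  from S_eq_sum_tz_count[OF this, of t "2 * h" "n + 2"]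
  have "int (S t (2 ^ (n + 3))) = (\<Sum>D\<in>{0..<2 ^ (n + 3)}. of_bool (odd ((2 * h)\<^sup>2 - D)) * (tz_count (2 ^ (n + 3)) D)\<^sup>2)"
    by (simp add: h numeral_3_eq_3)
  also have "\<dots> = 35 * 2 ^ (5 * n + 9)"
    unfolding sum_tz_count_sq_odd_2[symmetric] by (rule sum.cong) auto
  finally show ?thesis .
qed

text \<open>Half of t is odd, so odd u correspond to even D. The value is the full sum minus its odd
  part, with 103 = 13 * 16 - 3 * 35.\<close>

lemma S_2_not_dvd_4:
  assumes "even t" "\<not> 4 dvd t"
  shows "3 * int (S t (2 ^ (n + 3))) = 103 * 2 ^ (5 * n + 9) - 2 ^ (3 * n + 9)"
proof -
  obtain h where h: "t = 2 * h" using assms(1) by (elim evenE)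
  with assms(2) have "odd h" by presburger
  have "prime (2::int)" by simp
  from S_eq_sum_tz_count[OF this, of t h "n + 2"]
  have "int (S t (2 ^ (n + 3))) = (\<Sum>D\<in>{0..<2 ^ (n + 3)}. of_bool (odd (h\<^sup>2 - D)) * (tz_count (2 ^ (n + 3)) D)\<^sup>2)"
    by (simp add: h numeral_3_eq_3)
  also have "\<dots> = (\<Sum>D\<in>{0..<2 ^ (n + 3)}. of_bool (even D) * (tz_count (2 ^ (n + 3)) D)\<^sup>2)"
    using \<open>odd h\<close> by (intro sum.cong) auto
  finally have "(\<Sum>D\<in>{0..<2 ^ (n + 3)}. (tz_count (2 ^ (n + 3)) D)\<^sup>2) = 35 * 2 ^ (5 * n + 9) + int (S t (2 ^ (n + 3)))"
    using sum_tz_count_sq_split[of "2 ^ (n + 3)" "{0..<2 ^ (n + 3)}" 2] sum_tz_count_sq_odd_2[of n]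
    by (simp only:)
  moreover have "3 * (\<Sum>D\<in>{0..<2 ^ (n + 3)}. (tz_count (2 ^ (n + 3)) D)\<^sup>2) = 13 * 2 ^ (5 * n + 13) - 2 ^ (3 * n + 9)"
  proof -
    have "Suc (n + 2) = n + 3" "5 * (n + 2) + 3 = 5 * n + 13" "3 * (n + 2) + 3 = 3 * n + 9" by simp_all
    then show ?thesis using sum_tz_count_sq_2[of "n + 2"] by (simp only:)
  qed
  moreover have "(2::int) ^ (5 * n + 13) = 16 * 2 ^ (5 * n + 9)" by (simp add: power_add)
  ultimately show ?thesis by linarith
qed

theorem theorem1p4:
  fixes l k :: nat and t :: int
  assumes "prime l" and "k \<ge> 3"
  shows
    "(int l dvd t \<and> l > 2 \<longrightarrow>
        real (S t (int l ^ k)) / real l ^ (5 * k - 5) =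
          real l ^ 2 * (real l ^ 2 + 1) * (real l - 1)) \<and>
     (\<not> int l dvd 2 * t \<longrightarrow>
        real (S t (int l ^ k)) / real l ^ (5 * k - 5) =
          real l ^ 2 * (real l ^ 4 - 2 * real l ^ 2 - 3 * real l - 1) / (real l + 1)
          - real l ^ 4 / (real l ^ (2 * k) * (real l + 1))) \<and>
     (l = 2 \<and> \<not> 2 dvd t \<longrightarrow>
        real (S t (int l ^ k)) / real l ^ (5 * k - 5) = 4) \<and>
     (l = 2 \<and> 4 dvd t \<longrightarrow>
        real (S t (int l ^ k)) / real l ^ (5 * k - 5) = 35 / 2) \<and>
     (l = 2 \<and> 2 dvd t \<and> \<not> 4 dvd t \<longrightarrow>
        real (S t (int l ^ k)) / real l ^ (5 * k - 5) =
          103 / 6 - 32 / (3 * 2 ^ (2 * k)))"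
proof -
  \<comment> \<open>The formulas for odd l and for odd t use the exponent \<open>Suc n\<close>,
    those for l = 2 and even t the exponent m + 3.\<close>
  obtain m where k: "k = m + 3" using \<open>k \<ge> 3\<close> by (metis add.commute le_Suc_ex)
  define n where "n = m + 2"
  have kn: "k = Suc n" and e: "5 * k - 5 = 5 * n" by (simp_all add: k n_def)
  have pl: "prime (int l)" using \<open>prime l\<close> by simp
  have l0: "real l > 0" using \<open>prime l\<close> by (simp add: prime_gt_0_nat)
  have real: "real (S t (int l ^ k)) = real_of_int (int (S t (int l ^ Suc n)))" by (simp add: kn)
  have "real (S t (int l ^ k)) / real l ^ (5 * k - 5) = real l ^ 2 * (real l ^ 2 + 1) * (real l - 1)"
    if "int l dvd t" "l > 2"
  proof -
    have "\<not> int l dvd 2" using \<open>l > 2\<close> by (auto dest: zdvd_imp_le)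
    then show ?thesis
      unfolding real e S_odd_dvd[OF pl \<open>\<not> int l dvd 2\<close> \<open>int l dvd t\<close>] using l0 by simp
  qed
  moreover have "real (S t (int l ^ k)) / real l ^ (5 * k - 5) =
      real l ^ 2 * (real l ^ 4 - 2 * real l ^ 2 - 3 * real l - 1) / (real l + 1)
      - real l ^ 4 / (real l ^ (2 * k) * (real l + 1))"
    if "\<not> int l dvd 2 * t"
  proof -
    define x where "x = real l"
    define q where "q = x ^ n"
    have x0: "x > 0" "q > 0" using l0 by (simp_all add: x_def q_def)
    have "real_of_int ((int l + 1) * int (S t (int l ^ Suc n)))
        = real_of_int (int l ^ (5 * n + 2) * (int l ^ 4 - 2 * (int l)\<^sup>2 - 3 * int l - 1) - int l ^ (3 * n + 2))"
      using S_odd_not_dvd[OF pl that, of n] by (simp only:)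
    then have "(x + 1) * real (S t (int l ^ k)) = x ^ (5 * n + 2) * (x ^ 4 - 2 * x\<^sup>2 - 3 * x - 1) - x ^ (3 * n + 2)"
      unfolding real by (simp add: x_def)
    moreover have "x ^ (5 * n + 2) = q ^ 5 * x\<^sup>2" "x ^ (3 * n + 2) = q ^ 3 * x\<^sup>2"
      "x ^ (5 * n) = q ^ 5" "x ^ (2 * k) = q\<^sup>2 * x\<^sup>2"
      by (simp_all add: q_def kn power_add mult.commute[of _ n] power_mult power2_eq_square power_mult_distrib)
    ultimately have *: "(x + 1) * real (S t (int l ^ k)) = q ^ 5 * x\<^sup>2 * (x ^ 4 - 2 * x\<^sup>2 - 3 * x - 1) - q ^ 3 * x\<^sup>2"
      and pw: "x ^ (5 * n) = q ^ 5" "x ^ (2 * k) = q\<^sup>2 * x\<^sup>2" by simp_all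
    \<comment> \<open>The quotient x^2 / q^2 is extended by x^2, because q^2 x^2 is the x^(2 k) of
      the stated form.\<close>
    have quot: "(q ^ 5 * x\<^sup>2 * p - q ^ 3 * x\<^sup>2) / (x + 1) / q ^ 5 = x\<^sup>2 * p / (x + 1) - x ^ 4 / (q\<^sup>2 * x\<^sup>2 * (x + 1))" for p
      using x0 by (simp add: divide_simps) (simp add: eval_nat_numeral algebra_simps)
    have "real (S t (int l ^ k)) = (q ^ 5 * x\<^sup>2 * (x ^ 4 - 2 * x\<^sup>2 - 3 * x - 1) - q ^ 3 * x\<^sup>2) / (x + 1)"
      using * x0 by (simp add: field_simps)
    then have "real (S t (int l ^ k)) / x ^ (5 * n) = x\<^sup>2 * (x ^ 4 - 2 * x\<^sup>2 - 3 * x - 1) / (x + 1) - x ^ 4 / (x ^ (2 * k) * (x + 1))"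
      unfolding pw by (simp only: quot)
    then show ?thesis by (simp add: e x_def)
  qed
  moreover have "real (S t (int l ^ k)) / real l ^ (5 * k - 5) = 4" if "l = 2" "\<not> 2 dvd t"
    unfolding real e using S_2_odd[OF that(2), of n] \<open>l = 2\<close> by simp
  moreover have "real (S t (int l ^ k)) / real l ^ (5 * k - 5) = 35 / 2" if "l = 2" "4 dvd t"
  proof -
    have "real_of_int (int (S t (2 ^ (m + 3)))) = real_of_int (35 * 2 ^ (5 * m + 9))"
      using S_2_dvd_4[OF that(2), of m] by (simp only:)
    then show ?thesis using \<open>l = 2\<close> by (simp add: k power_add)
  qed
  moreover have "real (S t (int l ^ k)) / real l ^ (5 * k - 5) = 103 / 6 - 32 / (3 * 2 ^ (2 * k))"
    if "l = 2" "2 dvd t" "\<not> 4 dvd t"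
  proof -
    define q :: real where "q = 2 ^ m"
    have q0: "q > 0" by (simp add: q_def)
    have "real_of_int (3 * int (S t (2 ^ (m + 3)))) = real_of_int (103 * 2 ^ (5 * m + 9) - 2 ^ (3 * m + 9))"
      using S_2_not_dvd_4[OF that(2,3), of m] by (simp only:)
    then have "3 * real (S t (2 ^ (m + 3))) = 103 * (512 * q ^ 5) - 512 * q ^ 3"
      by (simp add: q_def power_add mult.commute[of _ m] power_mult)
    moreover have "(2::real) ^ (5 * k - 5) = 1024 * q ^ 5" "(2::real) ^ (2 * k) = 64 * q\<^sup>2"
      by (simp_all add: k q_def power_add mult.commute[of _ m] power_mult)
    moreover have "(103 * (512 * q ^ 5) - 512 * q ^ 3) / 3 / (1024 * q ^ 5) = 103 / 6 - 32 / (3 * (64 * q\<^sup>2))"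
      using q0 by (simp add: divide_simps) (simp add: eval_nat_numeral algebra_simps)
    moreover have "real (S t (int l ^ k)) = 3 * real (S t (2 ^ (m + 3))) / 3"
      using \<open>l = 2\<close> by (simp add: k)
    moreover have "real l = 2" using \<open>l = 2\<close> by simp
    ultimately show ?thesis by (simp only:)
  qed
  ultimately show ?thesis by blast
qed

end
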